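(* Let $d\ge 1$, let $\mathbb{M}^d$ be either $\mathbb{R}^d$ or the flat torus $\mathbb{T}^d$, let $\alpha=0$, and let $G(\mu)=\nabla\cdot(\mu\,H(\mu))$ for some bounded Borel function $H\colon \mathscr{M}_b^+\to\mathbb{R}^d$. Then the Dean--Kawasaki equation $$\mathrm{d}\mu_t = \alpha\,\Delta\mu_t\,\mathrm{d}t + G(\mu_t)\,\mathrm{d}t+\nabla\cdot(\sqrt{\mu_t}\,\xi)$$ has no solutions (in the martingale sense) for any initial condition $\mu_0\in\mathscr{M}_b^+$.
   Context: Notation. $\mathbb{M}^d$ is either the standard Euclidean space $\mathbb{R}^d$ or the flat $d$-dimensional torus $\mathbb{T}^d$. For $k\in\mathbb{N}_0$, $\mathcal{C}_b^k$ is the space of continuous bounded real-valued functions on $\mathbb{M}^d$ with continuous and bounded derivatives up to order $k$. For a Borel measure $\mu$ and a Borel function $f$ on $\mathbb{M}^d$, $\mu f:=\int f\,\mathrm{d}\mu$ whenever this makes sense. $\mathscr{M}_b^+$ is the space of all positive finite Borel measures on $\mathbb{M}^d$ with the narrow topology, i.e. the coarsest topology making $\mu\mapsto\mu f$ continuous for every $f\in\mathcal{C}_b^0$. The symbol $\xi$ denotes an $\mathbb{R}^d$-valued space-time white noise; solutions to the equation are understood in the sense of the following definition. Definition (martingale solution). Let $\alpha\ge 0$, let $H\colon\mathscr{M}_b^+\to\mathbb{R}^d$ be Borel, and $G(\mu)=\nabla\cdot(\mu H(\mu))$. Fix $T\in(0,\infty)$ and a complete probability space $(\Omega,\mathscr{F},\mathbf{P})$.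 A continuous $\mathscr{M}_b^+$-valued process $\mu_\bullet=(\mu_t)_{t\in[0,T]}$ on $(\Omega,\mathscr{F})$ is a solution to the equation up to time $T$ if, for each $f\in\mathcal{C}_b^2$, the process $$M^f_t:=\mu_t f-\mu_0 f-\int_0^t\mu_s\left(\tfrac{\alpha}{2}\Delta f+\nabla f\cdot H(\mu_s)\right)\mathrm{d}s,\qquad t\in[0,T],$$ is a continuous $\mathbf{P}$-martingale with respect to the filtration $(\mathscr{F}_t)_{t\in[0,T]}$ generated by $\mu_\bullet$, with quadratic variation $[M^f]_t=\int_0^t\mu_s|\nabla f|^2\,\mathrm{d}s$, $t\in[0,T]$.
   Formalization: The initial condition μ_0 is assumed to be nonzero: for μ_0 = 0 the process constantly equal to the zero measure is a martingale solution, so the claim fails in that single case. *)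

theory Defs
  imports "HOL-Probability.Probability"
begin

section \<open>The flat torus\<close>

definition torus_rel :: "real ^ 'n \<Rightarrow> real ^ 'n \<Rightarrow> bool" where
  "torus_rel x y \<longleftrightarrow> (\<forall>i. x $ i - y $ i \<in> \<int>)"

quotient_type (overloaded) 'n torus = "real ^ 'n::finite" / torus_rel
  morphisms torus_rep torus_proj
proof (rule equivpI)
  show "reflp torus_rel"
    by (simp add: reflp_def torus_rel_def)
  show "symp torus_rel"
    by (auto simp: symp_def torus_rel_def intro: Ints_minus) (metis Ints_minus minus_diff_eq)
  show "transp torus_rel"
    by (auto simp: transp_def torus_rel_def) (metis Ints_add diff_add_cancel add_diff_eq)
qed

instantiation torus :: (finite) topological_space
begin

definition open_torus :: "'a torus set \<Rightarrow> bool" where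
  "open_torus U \<longleftrightarrow> open (torus_proj -` U)"

instance
proof
  show "open (UNIV :: 'a torus set)"
    by (simp add: open_torus_def)
  show "open (S \<inter> T)" if "open S" "open T" for S T :: "'a torus set"
    using that by (simp add: open_torus_def open_Int)
  show "open (\<Union>K)" if "\<forall>S\<in>K. open S" for K :: "'a torus set set"
    using that by (auto simp: open_torus_def vimage_Union)
qed

end

section \<open>Test functions\<close>

definition partial_deriv :: "'n \<Rightarrow> (real ^ 'n \<Rightarrow> real) \<Rightarrow> real ^ 'n \<Rightarrow> real" where
  "partial_deriv i g x = frechet_derivative g (at x) (axis i 1)"

primrec Cb_euclidean :: "nat \<Rightarrow> (real ^ 'n \<Rightarrow> real) set" where
  "Cb_euclidean 0 = {g. continuous_on UNIV g \<and> bounded (range g)}"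
| "Cb_euclidean (Suc k) =
    {g. bounded (range g) \<and> g differentiable_on UNIV \<and> (\<forall>i. partial_deriv i g \<in> Cb_euclidean k)}"

text \<open>
  Differential calculus on \<open>\<real>\<^sup>d\<close> and on the torus is treated uniformly through the covering map
  \<open>p\<close> from \<open>\<real>\<^sup>d\<close> onto the space, which is the identity for \<open>\<real>\<^sup>d\<close> and \<open>torus_proj\<close> for the torus:
  derivatives of \<open>f\<close> are those of the lift \<open>f \<circ> p\<close>. The lift to \<open>\<real>\<^sup>d\<close> of a function on the torus
  is periodic, and so are its derivatives, hence the choice of preimage made by \<open>inv p\<close> is immaterial.
\<close>

definition Cb :: "(real ^ 'n \<Rightarrow> 'm) \<Rightarrow> nat \<Rightarrow> ('m \<Rightarrow> real) set" where
  "Cb p k = {f. f \<circ> p \<in> Cb_euclidean k}"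

definition grad :: "(real ^ 'n \<Rightarrow> 'm) \<Rightarrow> ('m \<Rightarrow> real) \<Rightarrow> 'm \<Rightarrow> real ^ 'n" where
  "grad p f y = (\<chi> i. partial_deriv i (f \<circ> p) (inv p y))"

definition laplacian :: "(real ^ 'n \<Rightarrow> 'm) \<Rightarrow> ('m \<Rightarrow> real) \<Rightarrow> 'm \<Rightarrow> real" where
  "laplacian p f y = (\<Sum>i\<in>UNIV. partial_deriv i (partial_deriv i (f \<circ> p)) (inv p y))"

section \<open>Finite Borel measures with the narrow topology\<close>

text \<open>
  The zero measure belongs to this space. It is an absorbing state: the process constantly equal to
  it solves the Dean--Kawasaki equation, for all \<open>\<alpha>\<close> and \<open>H\<close>. Nonexistence can therefore only hold
  for nonzero initial conditions.
\<close>

definition finite_borel_measures :: "'m::topological_space measure set" where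
  "finite_borel_measures = {\<mu>. finite_measure \<mu> \<and> sets \<mu> = sets borel}"

definition narrow_topology :: "'m::topological_space measure topology" where
  "narrow_topology = topology_generated_by
     {{\<mu> \<in> finite_borel_measures. (\<integral>x. f x \<partial>\<mu>) \<in> U} | f U.
        continuous_on UNIV f \<and> bounded (range f) \<and> open (U :: real set)}"

lemma topspace_narrow_topology: "topspace narrow_topology = finite_borel_measures"
proof -
  have "finite_borel_measures \<in> {{\<mu> \<in> finite_borel_measures. (\<integral>x. f x \<partial>\<mu>) \<in> U} | f U.
      continuous_on UNIV f \<and> bounded (range f) \<and> open (U :: real set)}"
    by (rule CollectI, rule exI[of _ "\<lambda>_. 0"], rule exI[of _ UNIV]) (auto simp: image_constant_conv)
  then show ?thesis
    unfolding narrow_topology_def topology_generated_by_topspace by blast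
qed

definition borel_of :: "'a topology \<Rightarrow> 'a measure" where
  "borel_of X = sigma (topspace X) {U. openin X U}"

section \<open>Continuous martingales and quadratic variation on \<open>[0, T]\<close>\<close>

text \<open>
  Processes are functions of time and of \<open>\<omega>\<close>, in this order, and only their values at times in
  \<open>{0..T}\<close> matter. Filtrations are indexed by all reals, to match \<^const>\<open>stopping_time\<close>;
  the one generated by a process on \<open>{0..T}\<close> is trivial before \<open>0\<close> and constant after \<open>T\<close>.
\<close>

definition generated_filtration ::
  "'w measure \<Rightarrow> real \<Rightarrow> 'e measure \<Rightarrow> (real \<Rightarrow> 'w \<Rightarrow> 'e) \<Rightarrow> real \<Rightarrow> 'w measure" where
  "generated_filtration P T E X t =
     sigma (space P) {X s -` A \<inter> space P | s A. s \<in> {0..T} \<and> s \<le> t \<and> A \<in> sets E}"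

definition continuous_paths :: "'w measure \<Rightarrow> real \<Rightarrow> (real \<Rightarrow> 'w \<Rightarrow> real) \<Rightarrow> bool" where
  "continuous_paths P T X \<longleftrightarrow> (\<forall>\<omega>\<in>space P. continuous_on {0..T} (\<lambda>t. X t \<omega>))"

definition adapted_process :: "(real \<Rightarrow> 'w measure) \<Rightarrow> real \<Rightarrow> (real \<Rightarrow> 'w \<Rightarrow> real) \<Rightarrow> bool" where
  "adapted_process F T X \<longleftrightarrow> (\<forall>t\<in>{0..T}. X t \<in> borel_measurable (F t))"

definition martingale ::
  "'w measure \<Rightarrow> (real \<Rightarrow> 'w measure) \<Rightarrow> real \<Rightarrow> (real \<Rightarrow> 'w \<Rightarrow> real) \<Rightarrow> bool" where
  "martingale P F T X \<longleftrightarrow>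
     adapted_process F T X \<and>
     (\<forall>t\<in>{0..T}. integrable P (X t)) \<and>
     (\<forall>s\<in>{0..T}. \<forall>t\<in>{s..T}. AE \<omega> in P. real_cond_exp P (F s) (X t) \<omega> = X s \<omega>)"

definition continuous_local_martingale ::
  "'w measure \<Rightarrow> (real \<Rightarrow> 'w measure) \<Rightarrow> real \<Rightarrow> (real \<Rightarrow> 'w \<Rightarrow> real) \<Rightarrow> bool" where
  "continuous_local_martingale P F T X \<longleftrightarrow>
     adapted_process F T X \<and> continuous_paths P T X \<and>
     (\<exists>\<tau> :: nat \<Rightarrow> 'w \<Rightarrow> real.
        (\<forall>n. stopping_time F (\<tau> n)) \<and>
        (\<forall>n. \<forall>\<omega>\<in>space P. 0 \<le> \<tau> n \<omega> \<and> \<tau> n \<omega> \<le> \<tau> (Suc n) \<omega>) \<and>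
        (AE \<omega> in P. \<exists>n. T \<le> \<tau> n \<omega>) \<and>
        (\<forall>n. martingale P F T (\<lambda>t \<omega>. X (min t (\<tau> n \<omega>)) \<omega> - X 0 \<omega>)))"

text \<open>
  \<open>A\<close> is (a version of) the quadratic variation of the continuous martingale \<open>X\<close>: the continuous,
  adapted, nondecreasing process started at \<open>0\<close>, unique up to indistinguishability, for which
  \<open>X\<^sup>2 - A\<close> is a continuous local martingale.
\<close>

definition quadratic_variation ::
  "'w measure \<Rightarrow> (real \<Rightarrow> 'w measure) \<Rightarrow> real \<Rightarrow> (real \<Rightarrow> 'w \<Rightarrow> real) \<Rightarrow> (real \<Rightarrow> 'w \<Rightarrow> real) \<Rightarrow> bool" where
  "quadratic_variation P F T X A \<longleftrightarrow>
     adapted_process F T A \<and> continuous_paths P T A \<and>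
     (\<forall>\<omega>\<in>space P. A 0 \<omega> = 0 \<and> mono_on {0..T} (\<lambda>t. A t \<omega>)) \<and>
     continuous_local_martingale P F T (\<lambda>t \<omega>. (X t \<omega>)\<^sup>2 - A t \<omega>)"

section \<open>Martingale solutions of the Dean--Kawasaki equation\<close>

definition DK_process ::
  "(real ^ 'n \<Rightarrow> 'm::topological_space) \<Rightarrow> real \<Rightarrow> ('m measure \<Rightarrow> real ^ 'n)
     \<Rightarrow> (real \<Rightarrow> 'w \<Rightarrow> 'm measure) \<Rightarrow> ('m \<Rightarrow> real) \<Rightarrow> real \<Rightarrow> 'w \<Rightarrow> real" where
  "DK_process p \<alpha> H \<mu> f t \<omega> =
     (\<integral>x. f x \<partial>\<mu> t \<omega>) - (\<integral>x. f x \<partial>\<mu> 0 \<omega>) -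
     (LINT s:{0..t}|lborel. (\<integral>x. \<alpha> / 2 * laplacian p f x + grad p f x \<bullet> H (\<mu> s \<omega>) \<partial>\<mu> s \<omega>))"

definition DK_solution ::
  "(real ^ 'n \<Rightarrow> 'm::topological_space) \<Rightarrow> 'w measure \<Rightarrow> real \<Rightarrow> real \<Rightarrow> ('m measure \<Rightarrow> real ^ 'n)
     \<Rightarrow> (real \<Rightarrow> 'w \<Rightarrow> 'm measure) \<Rightarrow> bool" where
  "DK_solution p P T \<alpha> H \<mu> \<longleftrightarrow>
     (\<forall>t\<in>{0..T}. \<mu> t \<in> measurable P (borel_of narrow_topology)) \<and>
     (\<forall>\<omega>\<in>space P. continuous_map (top_of_set {0..T}) narrow_topology (\<lambda>t. \<mu> t \<omega>)) \<and>
     (let F = generated_filtration P T (borel_of narrow_topology) \<mu> in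
       \<forall>f\<in>Cb p 2.
         continuous_paths P T (DK_process p \<alpha> H \<mu> f) \<and>
         martingale P F T (DK_process p \<alpha> H \<mu> f) \<and>
         quadratic_variation P F T (DK_process p \<alpha> H \<mu> f)
           (\<lambda>t \<omega>. LINT s:{0..t}|lborel. (\<integral>x. (norm (grad p f x))\<^sup>2 \<partial>\<mu> s \<omega>)))"

end

(*
  Test a solution with the plane waves cos (2 pi N x_j) and sin (2 pi N x_j). Since H does not depend
  on the space variable, the drift only rotates the pair of observables, so it does not change the
  squared modulus of the Fourier coefficient, whereas the quadratic variations add up to
  (2 pi N)^2 m t, where m is the mass. The expected squared modulus thus grows by (2 pi N)^2 m T,
  but it is bounded by a multiple of m^2 for all N; hence m = 0.

  Ito's formula is needed only for the expectation of a square, where it follows from discretisation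
  in time. The drift is integrated along each path separately, so joint measurability in time and
  omega is never used.
*)
theory Submission
  imports Defs
begin

section \<open>Bounded martingales\<close>

text \<open>A solution comes with no bound uniform in \<omega>. The bounds are supplied by the
  frequency N = 0: the constant function 1 has zero gradient, so its martingale has zero quadratic
  variation, the total mass stays almost surely at its initial value m, and every wave observable is
  bounded by m. From then on boundedness turns the local martingale in the definition of quadratic
  variation into an identity between expectations.

  The two phases are treated one at a time. Adding the expected squares at phases 0 and pi/2 already
  makes the drifts cancel, so neither a complex-valued martingale nor a covariation occurs. The
  discretisation keeps the squares of the martingale part intact, and only Riemann-Stieltjes sums
  against the drift pass to the limit; convergence of sums of squared martingale increments is never
  at stake. Boundedness of \<open>H\<close> bounds the drift for each fixed N. This bound grows with
  N, which is harmless because the drift has cancelled before N is taken large.\<close>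

lemma AE_interval_at:
  assumes "AE \<omega> in P. \<forall>t\<in>{0..T::real}. Q t \<omega>" and "t \<in> {0..T}"
  shows "AE \<omega> in P. Q t \<omega>"
  using assms by auto

text \<open>\<open>Z\<close> is known at time s, so it can be moved inside the conditional
  expectation given \<open>F s\<close>, which replaces \<open>M t\<close> by \<open>M s\<close>. The
  bound on \<open>Z\<close> is only almost sure because the observables are controlled by the mass,
  which is itself known only up to a null set.\<close>

lemma martingale_increment_orthogonal:
  assumes "prob_space P" and sub: "subalgebra P (F s)"
    and M: "martingale P F T M" and st: "s \<in> {0..T}" "t \<in> {s..T}"
    and Z: "Z \<in> borel_measurable (F s)" and bZ: "AE \<omega> in P. \<bar>Z \<omega>\<bar> \<le> (c::real)"
  shows "integrable P (\<lambda>\<omega>. Z \<omega> * (M t \<omega> - M s \<omega>))"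
    and "(\<integral>\<omega>. Z \<omega> * (M t \<omega> - M s \<omega>) \<partial>P) = 0"
proof -
  interpret prob_space P by fact
  interpret finite_measure_subalgebra P "F s"
    by unfold_locales (rule sub)
  have t: "t \<in> {0..T}" using st by auto
  have ZP [measurable]: "Z \<in> borel_measurable P"
    by (rule measurable_from_subalg[OF sub Z])
  have int: "integrable P (M r)" if "r \<in> {0..T}" for r
    using M that unfolding martingale_def by blast
  have intZ: "integrable P (\<lambda>\<omega>. Z \<omega> * M r \<omega>)" if r: "r \<in> {0..T}" for r
  proof (rule Bochner_Integration.integrable_bound)
    show "integrable P (\<lambda>\<omega>. c * \<bar>M r \<omega>\<bar>)" using int[OF r] by simp
    show "(\<lambda>\<omega>. Z \<omega> * M r \<omega>) \<in> borel_measurable P" using int[OF r] by simp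
    show "AE \<omega> in P. norm (Z \<omega> * M r \<omega>) \<le> norm (c * \<bar>M r \<omega>\<bar>)"
      using bZ
    proof eventually_elim
      case (elim \<omega>)
      then have "\<bar>Z \<omega>\<bar> \<le> \<bar>c\<bar>" by linarith
      then show ?case by (simp add: abs_mult mult_right_mono)
    qed
  qed
  have "(\<integral>\<omega>. Z \<omega> * M t \<omega> \<partial>P) = (\<integral>\<omega>. Z \<omega> * real_cond_exp P (F s) (M t) \<omega> \<partial>P)"
    using real_cond_exp_intg(2)[OF intZ[OF t] Z] int[OF t] by simp
  also have "\<dots> = (\<integral>\<omega>. Z \<omega> * M s \<omega> \<partial>P)"
  proof (rule integral_cong_AE)
    have "AE \<omega> in P. real_cond_exp P (F s) (M t) \<omega> = M s \<omega>"
      using M st unfolding martingale_def by blast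
    then show "AE \<omega> in P. Z \<omega> * real_cond_exp P (F s) (M t) \<omega> = Z \<omega> * M s \<omega>"
      by eventually_elim simp
  qed (use int[OF st(1)] in auto)
  finally have eq: "(\<integral>\<omega>. Z \<omega> * M t \<omega> \<partial>P) = (\<integral>\<omega>. Z \<omega> * M s \<omega> \<partial>P)" .
  show "integrable P (\<lambda>\<omega>. Z \<omega> * (M t \<omega> - M s \<omega>))"
    using intZ[OF t] intZ[OF st(1)] by (simp add: right_diff_distrib)
  show "(\<integral>\<omega>. Z \<omega> * (M t \<omega> - M s \<omega>) \<partial>P) = 0"
    using intZ[OF t] intZ[OF st(1)] eq by (simp add: right_diff_distrib)
qed

lemma martingale_expectation:
  assumes "prob_space P" and "subalgebra P (F 0)" and "martingale P F T M" and t: "t \<in> {0..T}"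
  shows "(\<integral>\<omega>. M t \<omega> \<partial>P) = (\<integral>\<omega>. M 0 \<omega> \<partial>P)"
proof -
  have "(\<integral>\<omega>. 1 * (M t \<omega> - M 0 \<omega>) \<partial>P) = 0"
    by (rule martingale_increment_orthogonal(2)[OF assms(1-3), where c = 1]) (use t in auto)
  moreover have "integrable P (M t)" "integrable P (M 0)"
    using assms unfolding martingale_def by auto
  ultimately show ?thesis by simp
qed

text \<open>A discrete Ito formula. With x and y the increments of X and M over one cell, the
  increment of X^2 minus that of M^2 equals (x - y) times (2 X + x + y), plus 2 (X - M) y, all at
  the left endpoint. The last term has mean zero, and the first contains only the increment of the
  drift X - M as a factor.\<close>

lemma expectation_square_increment:
  fixes X M :: "real \<Rightarrow> 'w \<Rightarrow> real" and \<tau> :: "nat \<Rightarrow> real"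
  assumes P: "prob_space P" and sub: "\<And>t. t \<in> {0..T} \<Longrightarrow> subalgebra P (F t)"
    and M: "martingale P F T M" and X: "adapted_process F T X"
    and bX: "AE \<omega> in P. \<forall>t\<in>{0..T}. \<bar>X t \<omega>\<bar> \<le> c"
    and bM: "AE \<omega> in P. \<forall>t\<in>{0..T}. \<bar>M t \<omega>\<bar> \<le> c"
    and \<tau>: "mono \<tau>" "\<And>i. i \<le> n \<Longrightarrow> \<tau> i \<in> {0..T}"
  shows "(\<integral>\<omega>. (X (\<tau> n) \<omega>)\<^sup>2 - (X (\<tau> 0) \<omega>)\<^sup>2 \<partial>P) =
    (\<integral>\<omega>. (M (\<tau> n) \<omega>)\<^sup>2 - (M (\<tau> 0) \<omega>)\<^sup>2 \<partial>P) +
    (\<integral>\<omega>. (\<Sum>i<n. (X (\<tau> (Suc i)) \<omega> - X (\<tau> i) \<omega> - (M (\<tau> (Suc i)) \<omega> - M (\<tau> i) \<omega>)) *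
      (X (\<tau> (Suc i)) \<omega> + X (\<tau> i) \<omega> + (M (\<tau> (Suc i)) \<omega> - M (\<tau> i) \<omega>))) \<partial>P)"
    (is "?x = ?m + integral\<^sup>L P ?R")
proof -
  interpret prob_space P by fact
  \<comment> \<open>The martingale transform with coefficients 2 (X - M) frozen at left endpoints;
    each summand has mean zero by orthogonality.\<close>
  define Q where "Q \<omega> = (\<Sum>i<n. 2 * (X (\<tau> i) \<omega> - M (\<tau> i) \<omega>) * (M (\<tau> (Suc i)) \<omega> - M (\<tau> i) \<omega>))" for \<omega>
  have MF: "adapted_process F T M" using M by (simp add: martingale_def)
  have Xm: "X t \<in> borel_measurable (F t)" and Mm: "M t \<in> borel_measurable (F t)"
    if "t \<in> {0..T}" for t
    using that X MF by (auto simp: adapted_process_def)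
  have XP: "X t \<in> borel_measurable P" and MP: "M t \<in> borel_measurable P" if "t \<in> {0..T}" for t
    using measurable_from_subalg[OF sub[OF that]] Xm[OF that] Mm[OF that] by auto
  have sq: "integrable P (\<lambda>\<omega>. (Y \<omega>)\<^sup>2)" if "Y \<in> borel_measurable P" "AE \<omega> in P. \<bar>Y \<omega>\<bar> \<le> c" for Y :: "'w \<Rightarrow> real"
  proof (rule integrable_const_bound[where B = "c\<^sup>2"])
    show "AE \<omega> in P. norm ((Y \<omega>)\<^sup>2) \<le> c\<^sup>2"
      using that(2) by eventually_elim (simp add: abs_le_square_iff[symmetric])
  qed (use that(1) in measurable)
  have part: "integrable P (\<lambda>\<omega>. 2 * (X (\<tau> i) \<omega> - M (\<tau> i) \<omega>) * (M (\<tau> (Suc i)) \<omega> - M (\<tau> i) \<omega>)) \<and>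
     (\<integral>\<omega>. 2 * (X (\<tau> i) \<omega> - M (\<tau> i) \<omega>) * (M (\<tau> (Suc i)) \<omega> - M (\<tau> i) \<omega>) \<partial>P) = 0" if "i < n" for i
  proof -
    have i: "\<tau> i \<in> {0..T}" and Si: "\<tau> (Suc i) \<in> {\<tau> i..T}"
      using \<tau> that by (auto simp: mono_iff_le_Suc)
    have b: "AE \<omega> in P. \<bar>2 * (X (\<tau> i) \<omega> - M (\<tau> i) \<omega>)\<bar> \<le> 4 * c"
      using AE_interval_at[OF bX i] AE_interval_at[OF bM i] 
    proof eventually_elim
      case (elim \<omega>)
      show ?case
        using abs_triangle_ineq4[of "X (\<tau> i) \<omega>" "M (\<tau> i) \<omega>"] elim by (simp only: abs_mult) simp
    qed
    have m: "(\<lambda>\<omega>. 2 * (X (\<tau> i) \<omega> - M (\<tau> i) \<omega>)) \<in> borel_measurable (F (\<tau> i))"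
      using Xm[OF i] Mm[OF i] by simp
    show ?thesis
      using martingale_increment_orthogonal[OF P sub[OF i] M i Si m b] by simp
  qed
  have intQ: "integrable P Q" and Q0: "integral\<^sup>L P Q = 0"
    unfolding Q_def using part by (auto simp: Bochner_Integration.integral_sum)
  have pathwise: "(X (\<tau> n) \<omega>)\<^sup>2 - (X (\<tau> 0) \<omega>)\<^sup>2 = (M (\<tau> n) \<omega>)\<^sup>2 - (M (\<tau> 0) \<omega>)\<^sup>2 + ?R \<omega> + Q \<omega>" for \<omega>
  proof -
    have "(X (\<tau> n) \<omega>)\<^sup>2 - (X (\<tau> 0) \<omega>)\<^sup>2 = (\<Sum>i<n. (X (\<tau> (Suc i)) \<omega>)\<^sup>2 - (X (\<tau> i) \<omega>)\<^sup>2)"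
      by (rule sum_lessThan_telescope[symmetric])
    moreover have "(M (\<tau> n) \<omega>)\<^sup>2 - (M (\<tau> 0) \<omega>)\<^sup>2 = (\<Sum>i<n. (M (\<tau> (Suc i)) \<omega>)\<^sup>2 - (M (\<tau> i) \<omega>)\<^sup>2)"
      by (rule sum_lessThan_telescope[symmetric])
    ultimately show ?thesis
      by (simp add: Q_def sum.distrib[symmetric]) (intro sum.cong, auto simp: algebra_simps power2_eq_square)
  qed
  have "integrable P (\<lambda>\<omega>. (X (\<tau> i) \<omega>)\<^sup>2)" "integrable P (\<lambda>\<omega>. (M (\<tau> i) \<omega>)\<^sup>2)" if "i \<le> n" for i
    using sq[OF XP[OF \<tau>(2)[OF that]] AE_interval_at[OF bX \<tau>(2)[OF that]]]
      sq[OF MP[OF \<tau>(2)[OF that]] AE_interval_at[OF bM \<tau>(2)[OF that]]] by auto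
  then have intx: "integrable P (\<lambda>\<omega>. (X (\<tau> n) \<omega>)\<^sup>2 - (X (\<tau> 0) \<omega>)\<^sup>2)"
    and intm: "integrable P (\<lambda>\<omega>. (M (\<tau> n) \<omega>)\<^sup>2 - (M (\<tau> 0) \<omega>)\<^sup>2)" by simp_all
  have "?R = (\<lambda>\<omega>. ((X (\<tau> n) \<omega>)\<^sup>2 - (X (\<tau> 0) \<omega>)\<^sup>2) - ((M (\<tau> n) \<omega>)\<^sup>2 - (M (\<tau> 0) \<omega>)\<^sup>2) - Q \<omega>)"
    using pathwise by (auto simp: fun_eq_iff algebra_simps)
  then have "integral\<^sup>L P ?R = ?x - ?m - integral\<^sup>L P Q"
    using intx intm intQ by simp
  with Q0 show ?thesis by simp
qed

section \<open>Consequences of localization\<close>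

text \<open>The times are the minimum of t and the localizing times. The stopped processes are
  martingales by definition, so only their expectations at times 0 and t are compared. Monotonicity
  of the localizing times makes the sequence eventually equal to t, not merely convergent to
  it.\<close>

lemma continuous_local_martingale_localization:
  assumes P: "prob_space P" and sub: "subalgebra P (F 0)"
    and Z: "continuous_local_martingale P F T Z" and Z0: "\<And>\<omega>. \<omega> \<in> space P \<Longrightarrow> Z 0 \<omega> = 0"
    and t: "t \<in> {0..T}"
  obtains \<sigma> :: "nat \<Rightarrow> 'w \<Rightarrow> real" where
    "\<And>n \<omega>. \<omega> \<in> space P \<Longrightarrow> \<sigma> n \<omega> \<in> {0..T}"
    "AE \<omega> in P. \<forall>\<^sub>F n in sequentially. \<sigma> n \<omega> = t"
    "\<And>n. integrable P (\<lambda>\<omega>. Z (\<sigma> n \<omega>) \<omega>)"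
    "\<And>n. (\<integral>\<omega>. Z (\<sigma> n \<omega>) \<omega> \<partial>P) = 0"
proof -
  from Z obtain \<tau> :: "nat \<Rightarrow> 'w \<Rightarrow> real" where
    \<tau>: "\<And>n \<omega>. \<omega> \<in> space P \<Longrightarrow> 0 \<le> \<tau> n \<omega> \<and> \<tau> n \<omega> \<le> \<tau> (Suc n) \<omega>"
    and \<tau>T: "AE \<omega> in P. \<exists>n. T \<le> \<tau> n \<omega>"
    and mart: "\<And>n. martingale P F T (\<lambda>t \<omega>. Z (min t (\<tau> n \<omega>)) \<omega> - Z 0 \<omega>)"
    unfolding continuous_local_martingale_def by blast
  have zero: "integral\<^sup>L P (\<lambda>\<omega>. Z (min 0 (\<tau> n \<omega>)) \<omega> - Z 0 \<omega>) = 0" for n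
    using \<tau> by (intro Bochner_Integration.integral_eq_zero_AE) (auto simp: min_def)
  have int: "integrable P (\<lambda>\<omega>. Z (min t (\<tau> n \<omega>)) \<omega> - Z 0 \<omega>)" for n
    using mart[of n] t unfolding martingale_def by blast
  have E: "integral\<^sup>L P (\<lambda>\<omega>. Z (min t (\<tau> n \<omega>)) \<omega> - Z 0 \<omega>) = 0" for n
    using martingale_expectation[OF P sub mart t] zero by simp
  show thesis
  proof
    show "min t (\<tau> n \<omega>) \<in> {0..T}" if "\<omega> \<in> space P" for n \<omega>
      using \<tau>[OF that, of n] t by auto
    show "integrable P (\<lambda>\<omega>. Z (min t (\<tau> n \<omega>)) \<omega>)" for n
      using int[of n] Z0 by (simp cong: Bochner_Integration.integrable_cong)
    show "(\<integral>\<omega>. Z (min t (\<tau> n \<omega>)) \<omega> \<partial>P) = 0" for n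
      using E[of n] Z0 by (simp cong: Bochner_Integration.integral_cong)
    show "AE \<omega> in P. \<forall>\<^sub>F n in sequentially. min t (\<tau> n \<omega>) = t"
      using \<tau>T AE_space
    proof eventually_elim
      case (elim \<omega>)
      then obtain N where "T \<le> \<tau> N \<omega>" by blast
      moreover have "incseq (\<lambda>n. \<tau> n \<omega>)" using \<tau> elim by (simp add: incseq_Suc_iff)
      ultimately have "T \<le> \<tau> n \<omega>" if "n \<ge> N" for n
        using that by (meson incseqD order_trans)
      then have "min t (\<tau> n \<omega>) = t" if "n \<ge> N" for n
        using t that by (force simp: min_def)
      then show ?case unfolding eventually_sequentially by blast
    qed
  qed
qed

text \<open>The stopped values eventually coincide with \<open>Z t\<close> and are dominated by the
  constant c, so the zero expectations survive the limit.\<close>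

lemma bounded_local_martingale_expectation:
  assumes P: "prob_space P" and sub: "\<And>s. s \<in> {0..T} \<Longrightarrow> subalgebra P (F s)"
    and Z: "continuous_local_martingale P F T Z" and Z0: "\<And>\<omega>. \<omega> \<in> space P \<Longrightarrow> Z 0 \<omega> = 0"
    and bZ: "AE \<omega> in P. \<forall>t\<in>{0..T}. \<bar>Z t \<omega>\<bar> \<le> c" and t: "t \<in> {0..T}"
  shows "(\<integral>\<omega>. Z t \<omega> \<partial>P) = 0"
proof -
  interpret prob_space P by fact
  have s0: "subalgebra P (F 0)" using sub t by auto
  obtain \<sigma> :: "nat \<Rightarrow> 'a \<Rightarrow> real" where
    \<sigma>: "\<And>n \<omega>. \<omega> \<in> space P \<Longrightarrow> \<sigma> n \<omega> \<in> {0..T}"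
    and ev: "AE \<omega> in P. \<forall>\<^sub>F n in sequentially. \<sigma> n \<omega> = t"
    and int: "\<And>n. integrable P (\<lambda>\<omega>. Z (\<sigma> n \<omega>) \<omega>)"
    and E: "\<And>n. (\<integral>\<omega>. Z (\<sigma> n \<omega>) \<omega> \<partial>P) = 0"
    using continuous_local_martingale_localization[OF P s0 Z Z0 t] by blast
  have "(\<lambda>n. \<integral>\<omega>. Z (\<sigma> n \<omega>) \<omega> \<partial>P) \<longlonglongrightarrow> (\<integral>\<omega>. Z t \<omega> \<partial>P)"
  proof (rule integral_dominated_convergence[where w = "\<lambda>_. c"])
    show "Z t \<in> borel_measurable P"
      using Z t measurable_from_subalg[OF sub[OF t]]
      unfolding continuous_local_martingale_def adapted_process_def by blast
    show "AE \<omega> in P. (\<lambda>n. Z (\<sigma> n \<omega>) \<omega>) \<longlonglongrightarrow> Z t \<omega>"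
      using ev by eventually_elim (rule tendsto_eventually, auto elim: eventually_mono)
    show "AE \<omega> in P. norm (Z (\<sigma> n \<omega>) \<omega>) \<le> c" for n
      using bZ AE_space by eventually_elim (use \<sigma> in auto)
  qed (use int in auto)
  then show ?thesis using E by (simp add: LIMSEQ_const_iff)
qed

text \<open>Each stopped value is nonnegative with zero mean, hence almost surely zero, and one of
  them is the value at time t. Domination plays no part, so this applies before any bound on the
  mass is available.\<close>

lemma nonneg_local_martingale_zero:
  assumes P: "prob_space P" and sub: "subalgebra P (F 0)"
    and Z: "continuous_local_martingale P F T Z" and Z0: "\<And>\<omega>. \<omega> \<in> space P \<Longrightarrow> Z 0 \<omega> = 0"
    and nn: "\<And>t \<omega>. t \<in> {0..T} \<Longrightarrow> \<omega> \<in> space P \<Longrightarrow> 0 \<le> Z t \<omega>" and t: "t \<in> {0..T}"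
  shows "AE \<omega> in P. Z t \<omega> = 0"
proof -
  obtain \<sigma> :: "nat \<Rightarrow> 'a \<Rightarrow> real" where
    \<sigma>: "\<And>n \<omega>. \<omega> \<in> space P \<Longrightarrow> \<sigma> n \<omega> \<in> {0..T}"
    and ev: "AE \<omega> in P. \<forall>\<^sub>F n in sequentially. \<sigma> n \<omega> = t"
    and int: "\<And>n. integrable P (\<lambda>\<omega>. Z (\<sigma> n \<omega>) \<omega>)"
    and E: "\<And>n. (\<integral>\<omega>. Z (\<sigma> n \<omega>) \<omega> \<partial>P) = 0"
    using continuous_local_martingale_localization[OF P sub Z Z0 t] by blast
  have "AE \<omega> in P. Z (\<sigma> n \<omega>) \<omega> = 0" for n
    using integral_nonneg_eq_0_iff_AE[OF int, of n] E[of n] nn \<sigma> by (auto intro: AE_I2)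
  then have "AE \<omega> in P. \<forall>n. Z (\<sigma> n \<omega>) \<omega> = 0"
    by (simp add: AE_all_countable)
  with ev show ?thesis
    proof eventually_elim
    case (elim \<omega>)
    then obtain n where "\<sigma> n \<omega> = t" unfolding eventually_sequentially by blast
    with elim(2) show ?case by metis
  qed
qed

text \<open>Countably many null sets suffice for the rational times, and continuity carries the
  value zero to all other times.\<close>

lemma AE_zero_continuous_paths:
  fixes X :: "real \<Rightarrow> 'w \<Rightarrow> real"
  assumes T: "0 < T" and X: "continuous_paths P T X"
    and zero: "\<And>t. t \<in> {0..T} \<Longrightarrow> AE \<omega> in P. X t \<omega> = 0"
  shows "AE \<omega> in P. \<forall>t\<in>{0..T}. X t \<omega> = 0"
proof -
  have "AE \<omega> in P. \<forall>q\<in>{0..T} \<inter> \<rat>. X q \<omega> = 0"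
    using zero countable_rat by (subst AE_ball_countable) auto
  with AE_space show ?thesis
  proof eventually_elim
    case (elim \<omega>)
    have cont: "continuous_on {0..T} (\<lambda>t. X t \<omega>)"
      using X elim(1) unfolding continuous_paths_def by blast
    show ?case
    proof (rule ballI, rule ccontr)
      fix t assume t: "t \<in> {0..T}" and nz: "X t \<omega> \<noteq> 0"
      have "0 < \<bar>X t \<omega>\<bar>" using nz by simp
      then obtain d where d: "d > 0" "\<And>s. s \<in> {0..T} \<Longrightarrow> dist s t < d \<Longrightarrow> dist (X s \<omega>) (X t \<omega>) < \<bar>X t \<omega>\<bar>"
        using cont t unfolding continuous_on_iff by blast
      \<comment> \<open>Clipping keeps the rational inside the interval even when t is an endpoint;
        \<open>0 < T\<close> leaves room for it.\<close>
      have "max 0 (t - d) < min T (t + d)" using t d(1) T by auto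
      then obtain q where "q \<in> \<rat>" "max 0 (t - d) < q" "q < min T (t + d)"
        using Rats_dense_in_real by blast
      then have "q \<in> {0..T} \<inter> \<rat>" "dist q t < d" by (auto simp: dist_real_def)
      then show False using d(2)[of q] elim(2) by (auto simp: dist_real_def)
    qed
  qed
qed

section \<open>Riemann--Stieltjes sums\<close>

lemma set_integral_singleton_interval:
  fixes b :: "real \<Rightarrow> real"
  shows "(LINT r:{a..a}|lborel. b r) = 0"
  unfolding set_lebesgue_integral_def
proof (rule integral_eq_zero_AE)
  show "AE r in lborel. indicat_real {a..a} r *\<^sub>R b r = 0"
    using AE_lborel_singleton[of a] by eventually_elim simp
qed

lemma set_integral_interval_diff:
  fixes b :: "real \<Rightarrow> real"
  assumes b: "set_integrable lborel {0..T} b" and st: "0 \<le> s" "s \<le> t" "t \<le> T"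
  shows "(LINT r:{0..t}|lborel. b r) - (LINT r:{0..s}|lborel. b r) = (LINT r:{s<..t}|lborel. b r)"
proof -
  have "(LINT r:{0..s} \<union> {s<..t}|lborel. b r) = (LINT r:{0..s}|lborel. b r) + (LINT r:{s<..t}|lborel. b r)"
    by (rule set_integral_Un) (use st in \<open>auto intro: set_integrable_subset[OF b]\<close>)
  moreover have "{0..s} \<union> {s<..t} = {0..t}" using st by auto
  ultimately show ?thesis by simp
qed

lemma set_integrable_bounded:
  fixes b :: "real \<Rightarrow> real"
  assumes "set_borel_measurable lborel {0..T} b" and "\<And>s. s \<in> {0..T} \<Longrightarrow> \<bar>b s\<bar> \<le> C"
  shows "set_integrable lborel {0..T} b"
  unfolding set_integrable_def
proof (rule Bochner_Integration.integrable_bound)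
  show "integrable lborel (\<lambda>s. indicator {0..T} s * C)"
    by (intro integrable_mult_left integrable_real_indicator) (auto simp: emeasure_lborel_Icc_eq)
  show "(\<lambda>s. indicat_real {0..T} s *\<^sub>R b s) \<in> borel_measurable lborel"
    using assms(1) by (simp add: set_borel_measurable_def)
  show "AE s in lborel. norm (indicat_real {0..T} s *\<^sub>R b s) \<le> norm (indicat_real {0..T} s * C)"
    using assms(2) by (intro AE_I2) (fastforce simp: indicator_def)
qed

lemma set_integral_interval_bound:
  fixes b :: "real \<Rightarrow> real"
  assumes "set_integrable lborel {s<..t} b" and "\<And>r. r \<in> {s<..t} \<Longrightarrow> \<bar>b r\<bar> \<le> C" and "s \<le> t"
  shows "\<bar>LINT r:{s<..t}|lborel. b r\<bar> \<le> C * (t - s)"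
proof -
  have "norm (LINT r:{s<..t}|lborel. b r) \<le> (\<integral>r. indicator {s<..t} r * C \<partial>lborel)"
    unfolding set_lebesgue_integral_def
  proof (rule Bochner_Integration.integral_norm_bound_integral)
    show "integrable lborel (\<lambda>r. indicator {s<..t} r * C)"
      using assms(3) by (intro integrable_mult_left integrable_real_indicator) auto
    show "integrable lborel (\<lambda>r. indicat_real {s<..t} r *\<^sub>R b r)"
      using assms(1) by (simp add: set_integrable_def)
    show "norm (indicat_real {s<..t} r *\<^sub>R b r) \<le> indicator {s<..t} r * C" for r
      using assms(2) by (auto simp: indicator_def)
  qed
  also have "\<dots> = C * (t - s)"
    using assms(3) by simp
  finally show ?thesis by simp
qed

text \<open>\<open>D\<close> is Lipschitz with constant C, so replacing u by v on a cell costs at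
  most C times the cell length times their uniform distance there. The weights \<open>v n i\<close>
  need not be values of u: in the application they also contain a martingale increment, which is
  small but not zero.\<close>

lemma riemann_stieltjes_limit:
  fixes T :: real and b u :: "real \<Rightarrow> real" and v :: "nat \<Rightarrow> nat \<Rightarrow> real"
  defines "\<tau> n i \<equiv> real i * T / real n"
  defines "D t \<equiv> LINT r:{0..t}|lborel. b r"
  assumes T: "0 < T" and b: "set_integrable lborel {0..T} b" and C: "\<And>s. s \<in> {0..T} \<Longrightarrow> \<bar>b s\<bar> \<le> C"
    and u: "continuous_on {0..T} u"
    and v: "\<And>e. e > 0 \<Longrightarrow> \<forall>\<^sub>F n in sequentially. \<forall>i<n. \<forall>s\<in>{\<tau> n i..\<tau> n (Suc i)}. \<bar>v n i - u s\<bar> \<le> e"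
  shows "(\<lambda>n. \<Sum>i<n. (D (\<tau> n (Suc i)) - D (\<tau> n i)) * v n i) \<longlonglongrightarrow> (LINT s:{0..T}|lborel. u s * b s)"
proof (rule LIMSEQ_I)
  fix e :: real assume e: "e > 0"
  have C0: "0 \<le> C" using C[of 0] T by auto
  \<comment> \<open>The n cells contribute at most e' C T / n each, hence e' C T < e in total; the
    summand 1 keeps the denominator positive when C = 0.\<close>
  define e' where "e' = e / (2 * (C * T + 1))"
  have pos: "C * T + 1 > 0" using C0 T by (simp add: add_nonneg_pos)
  have e': "e' > 0" using e pos by (simp add: e'_def)
  have ub: "set_integrable lborel {0..T} (\<lambda>s. u s * b s)"
  proof -
    have "compact (u ` {0..T})" using u by (intro compact_continuous_image) auto
    then obtain K where K: "\<And>s. s \<in> {0..T} \<Longrightarrow> \<bar>u s\<bar> \<le> K"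
      using compact_imp_bounded bounded_iff by (metis imageI real_norm_def)
    show ?thesis
    proof (rule set_integrable_bounded[where C = "K * C"])
      have 1: "(\<lambda>s. indicat_real {0..T} s *\<^sub>R u s) \<in> borel_measurable borel"
        by (rule borel_measurable_continuous_on_indicator) (use u in auto)
      have 2: "(\<lambda>s. indicat_real {0..T} s *\<^sub>R b s) \<in> borel_measurable borel"
        using b by (simp add: set_integrable_def)
      have "(\<lambda>s. (indicat_real {0..T} s *\<^sub>R u s) * (indicat_real {0..T} s *\<^sub>R b s)) \<in> borel_measurable borel"
        using borel_measurable_times[OF 1 2] .
      also have "(\<lambda>s. (indicat_real {0..T} s *\<^sub>R u s) * (indicat_real {0..T} s *\<^sub>R b s)) =
          (\<lambda>s. indicat_real {0..T} s *\<^sub>R (u s * b s))"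
        by (auto simp: indicator_def)
      finally show "set_borel_measurable lborel {0..T} (\<lambda>s. u s * b s)"
        by (simp add: set_borel_measurable_def)
      show "\<bar>u s * b s\<bar> \<le> K * C" if "s \<in> {0..T}" for s
        using K[OF that] C[OF that] C0 by (simp add: abs_mult mult_mono')
    qed
  qed
  have "\<forall>\<^sub>F n in sequentially. (\<forall>i<n. \<forall>s\<in>{\<tau> n i..\<tau> n (Suc i)}. \<bar>v n i - u s\<bar> \<le> e') \<and> n > 0"
    using v[OF e'] eventually_gt_at_top[of 0] by eventually_elim auto
  then obtain N where N: "\<And>n. n \<ge> N \<Longrightarrow> (\<forall>i<n. \<forall>s\<in>{\<tau> n i..\<tau> n (Suc i)}. \<bar>v n i - u s\<bar> \<le> e') \<and> n > 0"
    unfolding eventually_sequentially by blast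
  show "\<exists>N. \<forall>n\<ge>N. norm ((\<Sum>i<n. (D (\<tau> n (Suc i)) - D (\<tau> n i)) * v n i) - (LINT s:{0..T}|lborel. u s * b s)) < e"
  proof (intro exI allI impI)
    fix n assume "n \<ge> N"
    with N have n: "n > 0" and close: "\<And>i s. i < n \<Longrightarrow> s \<in> {\<tau> n i..\<tau> n (Suc i)} \<Longrightarrow> \<bar>v n i - u s\<bar> \<le> e'" by auto
    have \<tau>0: "\<tau> n 0 = 0" and \<tau>n: "\<tau> n n = T" using n by (auto simp: \<tau>_def)
    have \<tau>len: "\<tau> n (Suc i) - \<tau> n i = T / n" for i by (simp add: \<tau>_def diff_divide_distrib[symmetric] left_diff_distrib[symmetric])
    have \<tau>mono: "\<tau> n i \<le> \<tau> n (Suc i)" for i using \<tau>len[of i] T by (smt (verit) divide_nonneg_nonneg of_nat_0_le_iff)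
    have \<tau>r: "0 \<le> \<tau> n i" "i \<le> n \<Longrightarrow> \<tau> n i \<le> T" for i using T n by (auto simp: \<tau>_def field_simps)
    define G where "G t = (LINT s:{0..t}|lborel. u s * b s)" for t
    have G0: "G 0 = 0"
      unfolding G_def by (rule set_integral_singleton_interval)
    have "(LINT s:{0..T}|lborel. u s * b s) = G (\<tau> n n) - G (\<tau> n 0)"
      using G0 \<tau>0 \<tau>n by (simp add: G_def)
    also have "\<dots> = (\<Sum>i<n. G (\<tau> n (Suc i)) - G (\<tau> n i))"
      by (rule sum_lessThan_telescope[symmetric])
    finally have "(\<Sum>i<n. (D (\<tau> n (Suc i)) - D (\<tau> n i)) * v n i) - (LINT s:{0..T}|lborel. u s * b s) =
        (\<Sum>i<n. (D (\<tau> n (Suc i)) - D (\<tau> n i)) * v n i - (G (\<tau> n (Suc i)) - G (\<tau> n i)))"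
      by (simp add: sum_subtractf)
    also have "\<bar>\<dots>\<bar> \<le> (\<Sum>i<n. \<bar>(D (\<tau> n (Suc i)) - D (\<tau> n i)) * v n i - (G (\<tau> n (Suc i)) - G (\<tau> n i))\<bar>)"
      by (rule sum_abs)
    also have "\<dots> \<le> (\<Sum>i<n. e' * C * (T / n))"
    proof (rule sum_mono)
      fix i assume "i \<in> {..<n}"
      then have i: "i < n" by simp
      let ?I = "{\<tau> n i<..\<tau> n (Suc i)}"
      have sub: "?I \<subseteq> {0..T}" using \<tau>r[of i] \<tau>r[of "Suc i"] i by auto
      have bI: "set_integrable lborel ?I b" and ubI: "set_integrable lborel ?I (\<lambda>s. u s * b s)"
        using set_integrable_subset[OF b _ sub] set_integrable_subset[OF ub _ sub] by auto
      have "(D (\<tau> n (Suc i)) - D (\<tau> n i)) * v n i = (LINT s:?I|lborel. v n i * b s)"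
        unfolding D_def using set_integral_interval_diff[OF b] \<tau>r[of i] \<tau>r[of "Suc i"] \<tau>mono[of i] i by simp
      moreover have "G (\<tau> n (Suc i)) - G (\<tau> n i) = (LINT s:?I|lborel. u s * b s)"
        unfolding G_def using set_integral_interval_diff[OF ub] \<tau>r[of i] \<tau>r[of "Suc i"] \<tau>mono[of i] i by simp
      moreover have vI: "set_integrable lborel ?I (\<lambda>s. v n i * b s)" using bI by simp
      ultimately have "(D (\<tau> n (Suc i)) - D (\<tau> n i)) * v n i - (G (\<tau> n (Suc i)) - G (\<tau> n i)) =
          (LINT s:?I|lborel. v n i * b s - u s * b s)"
        using ubI by simp
      also have "\<bar>\<dots>\<bar> \<le> e' * C * (\<tau> n (Suc i) - \<tau> n i)"
      proof (rule set_integral_interval_bound)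
        show "set_integrable lborel ?I (\<lambda>s. v n i * b s - u s * b s)" using vI ubI by simp
        show "\<bar>v n i * b s - u s * b s\<bar> \<le> e' * C" if "s \<in> ?I" for s
        proof -
          have "\<bar>v n i - u s\<bar> * \<bar>b s\<bar> \<le> e' * C"
            using close[OF i, of s] C[of s] that sub e' by (intro mult_mono) auto
          then show ?thesis by (simp add: abs_mult[symmetric] left_diff_distrib)
        qed
      qed (rule \<tau>mono)
      finally show "\<bar>(D (\<tau> n (Suc i)) - D (\<tau> n i)) * v n i - (G (\<tau> n (Suc i)) - G (\<tau> n i))\<bar> \<le> e' * C * (T / n)"
        using \<tau>len by simp
    qed
    also have "\<dots> = e' * (C * T)" using n by simp
    also have "\<dots> < e"
    proof -
      have "e' * (C * T) < e' * (2 * (C * T + 1))" using e' C0 T by (intro mult_strict_left_mono) (auto simp: add_nonneg_pos add.commute intro: order.strict_trans2)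
      then show ?thesis using pos by (simp add: e'_def)
    qed
    finally show "norm ((\<Sum>i<n. (D (\<tau> n (Suc i)) - D (\<tau> n i)) * v n i) - (LINT s:{0..T}|lborel. u s * b s)) < e"
      by simp
  qed
qed

text \<open>Uniform continuity on the compact interval. Letting both points range over the cell
  covers node against sample as well as node against node.\<close>

lemma uniform_grid_oscillation:
  fixes x :: "real \<Rightarrow> real"
  assumes T: "0 < T" and x: "continuous_on {0..T} x" and e: "e > 0"
  shows "\<forall>\<^sub>F n in sequentially. \<forall>i<n. \<forall>s\<in>{real i * T / real n..real (Suc i) * T / real n}.
    \<forall>r\<in>{real i * T / real n..real (Suc i) * T / real n}. \<bar>x r - x s\<bar> < e"
proof -
  have "uniformly_continuous_on {0..T} x" by (rule compact_uniformly_continuous[OF x]) simp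
  then obtain d where d: "d > 0"
    "\<And>r s. r \<in> {0..T} \<Longrightarrow> s \<in> {0..T} \<Longrightarrow> dist r s < d \<Longrightarrow> dist (x r) (x s) < e"
    using e unfolding uniformly_continuous_on_def by metis
  have "(\<lambda>n. T / real n) \<longlonglongrightarrow> 0" by (rule lim_const_over_n)
  then have "\<forall>\<^sub>F n in sequentially. T / real n < d" using d(1) by (rule order_tendstoD)
  with eventually_gt_at_top[of 0] show ?thesis
  proof eventually_elim
    case (elim n)
    show ?case
    proof (intro allI impI ballI)
      fix i s r
      let ?a = "real i * T / real n" and ?b = "real (Suc i) * T / real n"
      assume i: "i < n" and s: "s \<in> {?a..?b}" and r: "r \<in> {?a..?b}"
      have "?b - ?a = T / n" by (simp add: diff_divide_distrib[symmetric] left_diff_distrib[symmetric])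
      moreover have "0 \<le> ?a" using T by simp
      moreover have "real (Suc i) * T \<le> real n * T"
        using i T by (intro mult_right_mono) auto
      then have "?b \<le> T" using elim(1) by (simp add: divide_le_eq mult.commute)
      ultimately show "\<bar>x r - x s\<bar> < e"
        using d(2)[of r s] r s elim(2) by (auto simp: dist_real_def)
    qed
  qed
qed

section \<open>Semimartingales with absolutely continuous drift\<close>

text \<open>Ito's formula for the mean square, obtained by refining the uniform grid in the discrete
  formula: the terms in X^2 and M^2 see only the times 0 and T, so they do not change with the grid.
  The conditions on b for every \<omega> give the limit along every path, while the almost sure
  uniform bounds are those for dominated convergence.\<close>

lemma expectation_square_semimartingale:
  fixes X M b :: "real \<Rightarrow> 'w \<Rightarrow> real"
  assumes P: "prob_space P" and sub: "\<And>t. t \<in> {0..T} \<Longrightarrow> subalgebra P (F t)" and T: "0 < T"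
    and M: "martingale P F T M" "continuous_paths P T M"
    and X: "adapted_process F T X" "continuous_paths P T X"
    and b: "\<And>\<omega>. \<omega> \<in> space P \<Longrightarrow> set_borel_measurable lborel {0..T} (\<lambda>s. b s \<omega>)"
      "\<And>\<omega>. \<omega> \<in> space P \<Longrightarrow> bounded ((\<lambda>s. b s \<omega>) ` {0..T})"
    and bX: "AE \<omega> in P. \<forall>t\<in>{0..T}. \<bar>X t \<omega>\<bar> \<le> c"
    and bM: "AE \<omega> in P. \<forall>t\<in>{0..T}. \<bar>M t \<omega>\<bar> \<le> c"
    and bb: "AE \<omega> in P. \<forall>t\<in>{0..T}. \<bar>b t \<omega>\<bar> \<le> C"
    and drift: "\<And>t \<omega>. t \<in> {0..T} \<Longrightarrow> \<omega> \<in> space P \<Longrightarrow>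
      X t \<omega> - X 0 \<omega> - M t \<omega> = (LINT s:{0..t}|lborel. b s \<omega>)"
  shows "(\<integral>\<omega>. (X T \<omega>)\<^sup>2 - (X 0 \<omega>)\<^sup>2 \<partial>P) =
    (\<integral>\<omega>. (M T \<omega>)\<^sup>2 - (M 0 \<omega>)\<^sup>2 \<partial>P) + (\<integral>\<omega>. (LINT s:{0..T}|lborel. 2 * X s \<omega> * b s \<omega>) \<partial>P)"
proof -
  interpret prob_space P by fact
  define \<tau> where "\<tau> n i = real i * T / real n" for n i :: nat
  define D where "D t \<omega> = (LINT s:{0..t}|lborel. b s \<omega>)" for t \<omega>
  \<comment> \<open>The second factor of the discrete formula; by continuity of X and M it is
    uniformly close to 2 X on each cell of a fine grid.\<close>
  define v where "v \<omega> n i = X (\<tau> n (Suc i)) \<omega> + X (\<tau> n i) \<omega> + (M (\<tau> n (Suc i)) \<omega> - M (\<tau> n i) \<omega>)" for \<omega> n i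
  define R where "R n \<omega> = (\<Sum>i<n. (X (\<tau> n (Suc i)) \<omega> - X (\<tau> n i) \<omega> -
    (M (\<tau> n (Suc i)) \<omega> - M (\<tau> n i) \<omega>)) * v \<omega> n i)" for n \<omega>
  have \<tau>r: "\<tau> n i \<in> {0..T}" if "i \<le> n" for n i
  proof (cases "n = 0")
    case False
    then have "real i * T \<le> real n * T" using that T by (intro mult_right_mono) auto
    then show ?thesis using False T by (simp add: \<tau>_def divide_le_eq mult.commute)
  qed (use T that in \<open>simp add: \<tau>_def\<close>)
  have \<tau>len: "\<tau> n (Suc i) - \<tau> n i = T / n" for n i
    by (simp add: \<tau>_def diff_divide_distrib[symmetric] left_diff_distrib[symmetric])
  have \<tau>mono: "\<tau> n i \<le> \<tau> n (Suc i)" for n i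
    using \<tau>len[of n i] T by (smt (verit) divide_nonneg_nonneg of_nat_0_le_iff)
  have \<tau>0: "\<tau> n 0 = 0" for n by (simp add: \<tau>_def)
  have \<tau>n: "\<tau> n n = T" if "n > 0" for n using that by (simp add: \<tau>_def)
  have R_eq: "R n \<omega> = (\<Sum>i<n. (D (\<tau> n (Suc i)) \<omega> - D (\<tau> n i) \<omega>) * v \<omega> n i)" if "\<omega> \<in> space P" for n \<omega>
    unfolding R_def
  proof (intro sum.cong refl arg_cong2[where f = "(*)"])
    fix i assume "i \<in> {..<n}"
    then have "\<tau> n i \<in> {0..T}" "\<tau> n (Suc i) \<in> {0..T}" by (auto intro!: \<tau>r simp del: atLeastAtMost_iff)
    from drift[OF this(1) that] drift[OF this(2) that]
    show "X (\<tau> n (Suc i)) \<omega> - X (\<tau> n i) \<omega> - (M (\<tau> n (Suc i)) \<omega> - M (\<tau> n i) \<omega>) =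
        D (\<tau> n (Suc i)) \<omega> - D (\<tau> n i) \<omega>"
      by (simp add: D_def)
  qed
  have int_b: "set_integrable lborel {0..T} (\<lambda>s. b s \<omega>)" if \<omega>: "\<omega> \<in> space P" for \<omega>
  proof -
    obtain K where "\<And>s. s \<in> {0..T} \<Longrightarrow> \<bar>b s \<omega>\<bar> \<le> K"
      using b(2)[OF \<omega>] unfolding bounded_iff by (auto simp del: atLeastAtMost_iff)
    then show ?thesis using b(1)[OF \<omega>] by (rule set_integrable_bounded[rotated])
  qed
  have limit: "(\<lambda>n. R n \<omega>) \<longlonglongrightarrow> (LINT s:{0..T}|lborel. 2 * X s \<omega> * b s \<omega>)" if \<omega>: "\<omega> \<in> space P" for \<omega>
  proof -
    obtain K where K: "\<And>s. s \<in> {0..T} \<Longrightarrow> \<bar>b s \<omega>\<bar> \<le> K"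
      using b(2)[OF \<omega>] unfolding bounded_iff by (auto simp del: atLeastAtMost_iff)
    have Xc: "continuous_on {0..T} (\<lambda>s. X s \<omega>)" and Mc: "continuous_on {0..T} (\<lambda>s. M s \<omega>)"
      using X(2) M(2) \<omega> unfolding continuous_paths_def by auto
    show ?thesis
      unfolding R_eq[OF \<omega>] D_def \<tau>_def
    proof (rule riemann_stieltjes_limit[OF T int_b[OF \<omega>] K])
      show "continuous_on {0..T} (\<lambda>s. 2 * X s \<omega>)" using Xc by (intro continuous_intros)
      fix e :: real assume "e > 0"
      \<comment> \<open>One third for X at each of the two nodes, and one for the increment of
        M.\<close>
      then have e3: "e / 3 > 0" by simp
      show "\<forall>\<^sub>F n in sequentially. \<forall>i<n. \<forall>s\<in>{real i * T / real n..real (Suc i) * T / real n}.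
          \<bar>v \<omega> n i - 2 * X s \<omega>\<bar> \<le> e"
        using uniform_grid_oscillation[OF T Xc e3] uniform_grid_oscillation[OF T Mc e3]
      proof eventually_elim
        case (elim n)
        show ?case
        proof (intro allI impI ballI)
          fix i s assume i: "i < n" and s: "s \<in> {real i * T / real n..real (Suc i) * T / real n}"
          have l: "\<tau> n i \<in> {real i * T / real n..real (Suc i) * T / real n}"
            and r: "\<tau> n (Suc i) \<in> {real i * T / real n..real (Suc i) * T / real n}"
            using \<tau>mono[of n i] by (auto simp: \<tau>_def)
          have "\<bar>X (\<tau> n i) \<omega> - X s \<omega>\<bar> < e / 3" "\<bar>X (\<tau> n (Suc i)) \<omega> - X s \<omega>\<bar> < e / 3"
            using elim(1) i s l r by blast+
          moreover have "\<bar>M (\<tau> n (Suc i)) \<omega> - M (\<tau> n i) \<omega>\<bar> < e / 3"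
            using elim(2) i l r by blast
          ultimately show "\<bar>v \<omega> n i - 2 * X s \<omega>\<bar> \<le> e"
            unfolding v_def by linarith
        qed
      qed
    qed auto
  qed
  have XP: "X t \<in> borel_measurable P" and MP: "M t \<in> borel_measurable P" if "t \<in> {0..T}" for t
    using measurable_from_subalg[OF sub[OF that]] that X(1) M(1)
    unfolding martingale_def adapted_process_def by blast+
  have RP: "R n \<in> borel_measurable P" for n
  proof -
    have "(\<lambda>\<omega>. (X (\<tau> n (Suc i)) \<omega> - X (\<tau> n i) \<omega> - (M (\<tau> n (Suc i)) \<omega> - M (\<tau> n i) \<omega>)) * v \<omega> n i)
        \<in> borel_measurable P" if "i < n" for i
    proof -
      have "\<tau> n i \<in> {0..T}" "\<tau> n (Suc i) \<in> {0..T}" using that by (auto intro!: \<tau>r simp del: atLeastAtMost_iff)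
      note [measurable] = this[THEN XP] this[THEN MP]
      show ?thesis unfolding v_def by measurable
    qed
    then show ?thesis unfolding R_def by (intro borel_measurable_sum) auto
  qed
  have "(\<lambda>n. \<integral>\<omega>. R n \<omega> \<partial>P) \<longlonglongrightarrow> (\<integral>\<omega>. (LINT s:{0..T}|lborel. 2 * X s \<omega> * b s \<omega>) \<partial>P)"
  \<comment> \<open>The increments of D sum to at most C T in absolute value, and \<open>v\<close>
    consists of four terms bounded by c.\<close>
  proof (rule integral_dominated_convergence[where w = "\<lambda>_. C * T * (4 * c)"])
    \<comment> \<open>Measurability in \<omega> of the time integral is inherited from the discrete
      sums, of which it is a pointwise limit on all of \<open>space P\<close>.\<close>
    show "(\<lambda>\<omega>. LINT s:{0..T}|lborel. 2 * X s \<omega> * b s \<omega>) \<in> borel_measurable P"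
      by (rule borel_measurable_LIMSEQ_real[OF limit RP])
    show "AE \<omega> in P. (\<lambda>n. R n \<omega>) \<longlonglongrightarrow> (LINT s:{0..T}|lborel. 2 * X s \<omega> * b s \<omega>)"
      using limit by (rule AE_I2)
    show "AE \<omega> in P. norm (R n \<omega>) \<le> C * T * (4 * c)" for n
      using bX bM bb AE_space
    proof eventually_elim
      case (elim \<omega>)
      have "0 \<in> {0..T}" using T by simp
      with elim have c0: "0 \<le> c" and C0: "0 \<le> C" by fastforce+
      have "norm (R n \<omega>) \<le> (\<Sum>i<n. \<bar>D (\<tau> n (Suc i)) \<omega> - D (\<tau> n i) \<omega>\<bar> * \<bar>v \<omega> n i\<bar>)"
        unfolding R_eq[OF elim(4)] real_norm_def abs_mult[symmetric] by (rule sum_abs)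
      also have "\<dots> \<le> (\<Sum>i<n. C * (T / n) * (4 * c))"
      proof (intro sum_mono mult_mono)
        fix i assume "i \<in> {..<n}"
        then have i: "\<tau> n i \<in> {0..T}" and Si: "\<tau> n (Suc i) \<in> {0..T}" by (auto intro!: \<tau>r simp del: atLeastAtMost_iff)
        have "D (\<tau> n (Suc i)) \<omega> - D (\<tau> n i) \<omega> = (LINT s:{\<tau> n i<..\<tau> n (Suc i)}|lborel. b s \<omega>)"
          unfolding D_def
          by (rule set_integral_interval_diff[OF int_b[OF elim(4)]]) (use i Si \<tau>mono in auto)
        moreover have "\<bar>\<dots>\<bar> \<le> C * (\<tau> n (Suc i) - \<tau> n i)"
          by (rule set_integral_interval_bound)
            (use elim(3) i Si \<tau>mono in \<open>auto intro: set_integrable_subset[OF int_b[OF elim(4)]]\<close>)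
        ultimately show "\<bar>D (\<tau> n (Suc i)) \<omega> - D (\<tau> n i) \<omega>\<bar> \<le> C * (T / n)"
          by (simp add: \<tau>len)
        have "\<bar>X (\<tau> n i) \<omega>\<bar> \<le> c" "\<bar>X (\<tau> n (Suc i)) \<omega>\<bar> \<le> c" "\<bar>M (\<tau> n i) \<omega>\<bar> \<le> c" "\<bar>M (\<tau> n (Suc i)) \<omega>\<bar> \<le> c"
          using elim(1,2) i Si by auto
        then show "\<bar>v \<omega> n i\<bar> \<le> 4 * c" unfolding v_def by linarith
      qed (use C0 T in auto)
      \<comment> \<open>Equality for positive n; the inequality also covers the empty sum at n =
        0.\<close>
      also have "\<dots> \<le> C * T * (4 * c)" using c0 C0 T by simp
      finally show ?case .
    qed
  qed (use RP in auto)
  moreover have "\<forall>\<^sub>F n in sequentially. (\<integral>\<omega>. R n \<omega> \<partial>P) =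
      (\<integral>\<omega>. (X T \<omega>)\<^sup>2 - (X 0 \<omega>)\<^sup>2 \<partial>P) - (\<integral>\<omega>. (M T \<omega>)\<^sup>2 - (M 0 \<omega>)\<^sup>2 \<partial>P)"
    \<comment> \<open>For n = 0 division by zero gives \<open>\<tau> 0 0 = 0\<close>, so the last
      node is T only for positive n.\<close>
    using eventually_gt_at_top[of 0]
  proof eventually_elim
    case (elim n)
    have "mono (\<tau> n)" using \<tau>mono by (simp add: mono_iff_le_Suc)
    from expectation_square_increment[where n = n and \<tau> = "\<tau> n", OF P sub M(1) X(1) bX bM this \<tau>r]
    show ?case unfolding R_def v_def by (simp add: \<tau>0 \<tau>n[OF elim])
  qed
  ultimately have "(\<lambda>n::nat. (\<integral>\<omega>. (X T \<omega>)\<^sup>2 - (X 0 \<omega>)\<^sup>2 \<partial>P) - (\<integral>\<omega>. (M T \<omega>)\<^sup>2 - (M 0 \<omega>)\<^sup>2 \<partial>P))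
      \<longlonglongrightarrow> (\<integral>\<omega>. (LINT s:{0..T}|lborel. 2 * X s \<omega> * b s \<omega>) \<partial>P)"
    by (rule Lim_transform_eventually)
  then show ?thesis by (simp add: LIMSEQ_const_iff)
qed

section \<open>Plane waves\<close>

lemma plane_wave_has_derivative:
  fixes j :: "'n::finite"
  shows "((\<lambda>x::real^'n. c * cos (k * x $ j + b)) has_derivative (\<lambda>h. - (c * k * sin (k * x $ j + b)) * h $ j)) (at x)"
  by (auto intro!: derivative_eq_intros bounded_linear.has_derivative[OF bounded_linear_vec_nth])

text \<open>The derivative is written as a cosine with its phase advanced by pi/2 rather than as a
  sine. The family of waves is then closed under differentiation, and smoothness of every order
  follows by one induction over all phases and amplitudes.\<close>

lemma partial_deriv_plane_wave:
  fixes j :: "'n::finite"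
  shows "partial_deriv i (\<lambda>x::real^'n. c * cos (k * x $ j + b)) =
    (\<lambda>x. (if i = j then c * k else 0) * cos (k * x $ j + (b + pi / 2)))"
proof
  fix x :: "real^'n"
  have "frechet_derivative (\<lambda>x. c * cos (k * x $ j + b)) (at x) = (\<lambda>h. - (c * k * sin (k * x $ j + b)) * h $ j)"
    by (rule frechet_derivative_at[symmetric]) (rule plane_wave_has_derivative)
  moreover have "cos (k * x $ j + (b + pi / 2)) = - sin (k * x $ j + b)"
    using minus_sin_cos_eq[of "k * x $ j + b"] by (simp only: add.assoc of_real_eq_id id_apply)
  ultimately show "partial_deriv i (\<lambda>x. c * cos (k * x $ j + b)) x =
      (if i = j then c * k else 0) * cos (k * x $ j + (b + pi / 2))"
    by (simp add: partial_deriv_def axis_def)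
qed

lemma plane_wave_Cb_euclidean:
  fixes j :: "'n::finite"
  shows "(\<lambda>x::real^'n. c * cos (k * x $ j + b)) \<in> Cb_euclidean n"
proof (induction n arbitrary: b c)
  have bdd: "bounded (range (\<lambda>x::real^'n. c * cos (k * x $ j + b)))" for b c
    by (rule boundedI[of _ "\<bar>c\<bar>"]) (auto simp: abs_mult mult_left_le)
  {
    case 0
    show ?case using bdd by (auto intro!: continuous_intros)
  next
    case (Suc n)
    have "(\<lambda>x::real^'n. c * cos (k * x $ j + b)) differentiable_on UNIV"
      using plane_wave_has_derivative unfolding differentiable_on_def differentiable_def by blast
    moreover have "partial_deriv i (\<lambda>x::real^'n. c * cos (k * x $ j + b)) \<in> Cb_euclidean n" for i
      unfolding partial_deriv_plane_wave by (rule Suc)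
    ultimately show ?case
      using bdd by simp
  }
qed

text \<open>The common ground of the identity and \<open>torus_proj\<close>: a quotient topology,
  and fibres whose points differ by integer vectors.\<close>

locale flat_covering =
  fixes p :: "real ^ 'n::finite \<Rightarrow> 'm::topological_space"
  assumes open_iff: "open U \<longleftrightarrow> open (p -` U)"
    and period: "p x = p y \<Longrightarrow> x $ i - y $ i \<in> \<int>"
begin

text \<open>Phases 0 and pi/2 give the real part and minus the imaginary part of one Fourier mode;
  frequency and phase 0 give the constant 1.\<close>

definition wave :: "'n \<Rightarrow> nat \<Rightarrow> real \<Rightarrow> 'm \<Rightarrow> real" where
  "wave j N b y = cos (2 * pi * N * inv p y $ j + b)"

text \<open>The representative chosen by \<open>inv p\<close> differs from x by an integer in
  coordinate j, which shifts the argument of the cosine by a multiple of 2 pi because N is an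
  integer.\<close>

lemma wave_lift: "wave j N b \<circ> p = (\<lambda>x. 1 * cos (2 * pi * N * x $ j + b))"
proof
  fix x
  have "p (inv p (p x)) = p x" by (rule f_inv_into_f) simp
  then obtain m :: int where "inv p (p x) $ j - x $ j = of_int m"
    using period[of "inv p (p x)" x j] by (auto elim: Ints_cases)
  then have "2 * pi * N * inv p (p x) $ j + b = (2 * pi * N * x $ j + b) + of_int (int N * m) * (2 * pi)"
    by (simp add: algebra_simps)
  then show "(wave j N b \<circ> p) x = 1 * cos (2 * pi * N * x $ j + b)"
    using cos.plus_of_int[of "2 * pi * N * x $ j + b" "int N * m"]
    by (simp only: wave_def o_def id_apply of_real_eq_id mult_1)
qed

text \<open>Openness is tested on preimages under p, so continuity of the lift suffices.\<close>

lemma wave_continuous: "continuous_on UNIV (wave j N b)"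
proof -
  have "continuous_on UNIV (wave j N b \<circ> p)"
    unfolding wave_lift by (intro continuous_intros)
  then show ?thesis
    by (simp only: continuous_on_open_vimage[OF open_UNIV] open_iff vimage_comp Int_UNIV_right)
qed

lemma wave_bound: "\<bar>wave j N b y\<bar> \<le> 1"
  by (simp add: wave_def)

lemma wave_bounded: "bounded (range (wave j N b))"
  by (rule boundedI[of _ 1]) (use wave_bound in auto)

lemma wave_Cb: "wave j N b \<in> Cb p n"
  unfolding Cb_def mem_Collect_eq wave_lift by (rule plane_wave_Cb_euclidean)

lemma wave_zero: "wave j 0 0 y = 1"
  by (simp add: wave_def)

lemma wave_half_turn: "wave j N (b + pi) y = - wave j N b y"
  by (simp add: wave_def add.assoc[symmetric])

lemma wave_square_sum: "(wave j N (b + pi / 2) y)\<^sup>2 + (wave j N b y)\<^sup>2 = 1"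
proof -
  have "wave j N (b + pi / 2) y = - sin (2 * pi * N * inv p y $ j + b)"
    unfolding wave_def using minus_sin_cos_eq[of "2 * pi * N * inv p y $ j + b"] by (simp only: add.assoc of_real_eq_id id_apply)
  then show ?thesis by (simp add: wave_def)
qed

lemma grad_wave: "grad p (wave j N b) y = axis j (2 * pi * N * wave j N (b + pi / 2) y)"
proof -
  have "partial_deriv i (wave j N b \<circ> p) (inv p y) = axis j (2 * pi * N * wave j N (b + pi / 2) y) $ i" for i
    unfolding wave_lift partial_deriv_plane_wave by (auto simp: wave_def axis_def)
  then show ?thesis by (simp add: grad_def)
qed

end

lemma flat_covering_euclidean: "flat_covering (\<lambda>x::real^'n::finite. x)"
  by unfold_locales (auto simp: vimage_def)

lemma flat_covering_torus: "flat_covering (torus_proj :: real^'n::finite \<Rightarrow> 'n torus)"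
proof
  show "open U \<longleftrightarrow> open (torus_proj -` U)" for U :: "'n torus set"
    by (rule open_torus_def)
  show "x $ i - y $ i \<in> \<int>" if "torus_proj x = torus_proj y" for x y :: "real^'n" and i
    using that by (simp add: torus.abs_eq_iff torus_rel_def)
qed

section \<open>The narrow topology\<close>

lemma space_borel_of: "space (borel_of X) = topspace X"
  by (simp add: borel_of_def space_measure_of_conv)

lemma sets_borel_of_openin: "openin X U \<Longrightarrow> U \<in> sets (borel_of X)"
  unfolding borel_of_def by (subst sets_measure_of) (auto dest: openin_subset)

lemma continuous_map_borel_of_measurable:
  assumes "continuous_map X euclidean f"
  shows "f \<in> borel_measurable (borel_of X)"
proof (rule borel_measurableI)
  fix S :: "'b set" assume "open S"
  then have "openin X {x \<in> topspace X. f x \<in> S}"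
    using assms by (simp add: continuous_map_def)
  moreover have "{x \<in> topspace X. f x \<in> S} = f -` S \<inter> space (borel_of X)"
    by (auto simp: space_borel_of)
  ultimately show "f -` S \<inter> space (borel_of X) \<in> sets (borel_of X)"
    using sets_borel_of_openin by metis
qed

text \<open>Used for one path \<omega> at a time: composed with the Borel map \<open>H\<close>, it
  makes the drift coefficient measurable in time.\<close>

lemma continuous_map_into_borel_of_measurable:
  fixes S :: "'a::topological_space set"
  assumes f: "continuous_map (top_of_set S) X f"
  shows "f \<in> restrict_space borel S \<rightarrow>\<^sub>M borel_of X"
  unfolding borel_of_def
proof (rule measurable_measure_of)
  show "{U. openin X U} \<subseteq> Pow (topspace X)" by (auto dest: openin_subset)
  show "f \<in> space (restrict_space borel S) \<rightarrow> topspace X"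
    using f by (auto simp: continuous_map_def space_restrict_space)
  fix U assume "U \<in> {U. openin X U}"
  then have "openin (top_of_set S) {x \<in> S. f x \<in> U}"
    using f by (simp add: continuous_map_def)
  then obtain V where "open V" "{x \<in> S. f x \<in> U} = S \<inter> V"
    by (auto simp: openin_open)
  moreover have "f -` U \<inter> space (restrict_space borel S) = {x \<in> S. f x \<in> U}"
    by (auto simp: space_restrict_space)
  ultimately show "f -` U \<inter> space (restrict_space borel S) \<in> sets (restrict_space borel S)"
    by (auto simp: sets_restrict_space)
qed

lemma continuous_map_narrow_integral:
  assumes "continuous_on UNIV f" and "bounded (range f)"
  shows "continuous_map narrow_topology euclideanreal (\<lambda>\<nu>. \<integral>x. f x \<partial>\<nu>)"
  unfolding continuous_map_def topspace_narrow_topology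
proof (intro conjI allI impI)
  fix U :: "real set" assume "openin euclidean U"
  then show "openin narrow_topology {\<nu> \<in> finite_borel_measures. (\<integral>x. f x \<partial>\<nu>) \<in> U}"
    unfolding narrow_topology_def using assms by (intro topology_generated_by_Basis) auto
qed simp

lemma finite_borel_measures_integrable:
  fixes f :: "'m::topological_space \<Rightarrow> real"
  assumes "\<nu> \<in> finite_borel_measures" and "continuous_on UNIV f" and "bounded (range f)"
  shows "integrable \<nu> f"
proof -
  interpret finite_measure \<nu> using assms by (simp add: finite_borel_measures_def)
  have "f \<in> borel_measurable \<nu>"
    using assms(1) borel_measurable_continuous_onI[OF assms(2)] measurable_cong_sets[of \<nu> borel borel borel]
    by (auto simp: finite_borel_measures_def)
  moreover obtain B where "\<And>x. norm (f x) \<le> B" using assms(3) by (auto simp: bounded_iff)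
  ultimately show ?thesis by (intro integrable_const_bound[of _ B]) auto
qed

lemma finite_borel_measures_integral_bound:
  fixes f :: "'m::topological_space \<Rightarrow> real"
  assumes "\<nu> \<in> finite_borel_measures" and "continuous_on UNIV f" and f: "\<And>x. \<bar>f x\<bar> \<le> 1"
  shows "\<bar>\<integral>x. f x \<partial>\<nu>\<bar> \<le> (\<integral>x. 1 \<partial>\<nu>)"
proof -
  have int: "integrable \<nu> f"
    by (rule finite_borel_measures_integrable[OF assms(1,2)]) (auto intro!: boundedI[of _ 1] f)
  have "\<bar>\<integral>x. f x \<partial>\<nu>\<bar> \<le> (\<integral>x. \<bar>f x\<bar> \<partial>\<nu>)"
    by (rule integral_abs_bound)
  also have "\<dots> \<le> (\<integral>x. 1 \<partial>\<nu>)"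
  proof (rule integral_mono)
    show "integrable \<nu> (\<lambda>_. 1::real)"
      by (rule finite_borel_measures_integrable[OF assms(1)]) (auto simp: image_constant_conv)
  qed (use int f in auto)
  finally show ?thesis .
qed

lemma space_generated_filtration: "space (generated_filtration P T E X t) = space P"
  by (simp add: generated_filtration_def space_measure_of_conv)

lemma generated_filtration_measurable:
  assumes "s \<in> {0..T}" and "s \<le> t" and "X s \<in> space P \<rightarrow> space E"
  shows "X s \<in> generated_filtration P T E X t \<rightarrow>\<^sub>M E"
proof (rule measurableI)
  fix A assume A: "A \<in> sets E"
  have "X s -` A \<inter> space P \<in> {X s -` A \<inter> space P | s A. s \<in> {0..T} \<and> s \<le> t \<and> A \<in> sets E}"
    using assms A by blast
  then show "X s -` A \<inter> space (generated_filtration P T E X t) \<in> sets (generated_filtration P T E X t)"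
    unfolding space_generated_filtration unfolding generated_filtration_def
    by (subst sets_measure_of) auto
qed (use assms in \<open>auto simp: space_generated_filtration\<close>)

lemma subalgebra_generated_filtration:
  assumes "\<And>s. s \<in> {0..T} \<Longrightarrow> X s \<in> P \<rightarrow>\<^sub>M E"
  shows "subalgebra P (generated_filtration P T E X t)"
proof -
  have "sets (generated_filtration P T E X t) \<subseteq> sets P"
    unfolding generated_filtration_def
    by (subst sets_measure_of) (auto intro!: sets.sigma_sets_subset measurable_sets[OF assms])
  then show ?thesis by (simp add: subalgebra_def space_generated_filtration)
qed

section \<open>Solutions tested against plane waves\<close>

text \<open>The assumptions from which the initial mass will be shown to vanish; the drift parameter
  \<alpha> is fixed to 0 in \<open>sol\<close>.\<close>

locale DK_inviscid = flat_covering p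
  for p :: "real ^ 'n::finite \<Rightarrow> 'm::topological_space" +
  fixes P :: "'w measure" and T :: real and H :: "'m measure \<Rightarrow> real ^ 'n"
    and \<mu> :: "real \<Rightarrow> 'w \<Rightarrow> 'm measure"
  assumes P: "prob_space P" and T: "0 < T"
    and H: "H \<in> borel_measurable (borel_of narrow_topology)"
    and bounded_H: "bounded (H ` finite_borel_measures)"
    and sol: "DK_solution p P T 0 H \<mu>"
begin

section \<open>Observables and their drift\<close>

abbreviation "\<F> \<equiv> generated_filtration P T (borel_of narrow_topology) \<mu>"

definition obs :: "('m \<Rightarrow> real) \<Rightarrow> real \<Rightarrow> 'w \<Rightarrow> real" where
  "obs f t \<omega> = (\<integral>x. f x \<partial>\<mu> t \<omega>)"

lemma subalgebra_filtration: "subalgebra P (\<F> t)"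
  using sol by (intro subalgebra_generated_filtration) (auto simp: DK_solution_def)

lemma path_continuous:
  "\<omega> \<in> space P \<Longrightarrow> continuous_map (top_of_set {0..T}) narrow_topology (\<lambda>t. \<mu> t \<omega>)"
  using sol by (auto simp: DK_solution_def)

lemma finite_borel_measures_path:
  assumes "t \<in> {0..T}" and "\<omega> \<in> space P"
  shows "\<mu> t \<omega> \<in> finite_borel_measures"
  using path_continuous[OF assms(2)] assms(1) by (auto simp: continuous_map_def topspace_narrow_topology)

lemma DK_martingale:
  assumes "f \<in> Cb p 2"
  shows "continuous_paths P T (DK_process p 0 H \<mu> f)"
    and "martingale P \<F> T (DK_process p 0 H \<mu> f)"
    and "quadratic_variation P \<F> T (DK_process p 0 H \<mu> f)
      (\<lambda>t \<omega>. LINT s:{0..t}|lborel. obs (\<lambda>x. (norm (grad p f x))\<^sup>2) s \<omega>)"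
  using sol assms by (auto simp: DK_solution_def Let_def obs_def)

lemma obs_adapted:
  assumes "continuous_on UNIV f" and "bounded (range f)"
  shows "adapted_process \<F> T (obs f)"
  unfolding adapted_process_def
proof
  fix t assume t: "t \<in> {0..T}"
  have "\<mu> t \<in> \<F> t \<rightarrow>\<^sub>M borel_of narrow_topology"
    by (rule generated_filtration_measurable)
      (use t finite_borel_measures_path in \<open>auto simp: space_borel_of topspace_narrow_topology\<close>)
  from measurable_compose[OF this continuous_map_borel_of_measurable[OF continuous_map_narrow_integral[OF assms]]]
  show "obs f t \<in> borel_measurable (\<F> t)"
    unfolding obs_def .
qed

lemma obs_continuous:
  assumes "continuous_on UNIV f" and "bounded (range f)" and "\<omega> \<in> space P"
  shows "continuous_on {0..T} (\<lambda>t. obs f t \<omega>)"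
  using continuous_map_compose[OF path_continuous[OF assms(3)] continuous_map_narrow_integral[OF assms(1,2)]]
  by (simp add: obs_def o_def)

lemma obs_continuous_paths:
  assumes "continuous_on UNIV f" and "bounded (range f)"
  shows "continuous_paths P T (obs f)"
  using obs_continuous[OF assms] by (auto simp: continuous_paths_def)

text \<open>The angular speed at which the drift rotates the pair of observables with phases 0 and
  pi/2.\<close>

definition speed :: "'n \<Rightarrow> nat \<Rightarrow> real \<Rightarrow> 'w \<Rightarrow> real" where
  "speed j N t \<omega> = 2 * pi * N * H (\<mu> t \<omega>) $ j"

text \<open>\<open>H\<close> depends on the measure but not on the point, so it leaves the spatial
  integral as a scalar; what remains is the observable with phase advanced by pi/2. The Laplacian
  carries the factor \<alpha> = 0.\<close>

lemma DK_process_wave: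
  "DK_process p 0 H \<mu> (wave j N b) t \<omega> = obs (wave j N b) t \<omega> - obs (wave j N b) 0 \<omega> -
    (LINT s:{0..t}|lborel. speed j N s \<omega> * obs (wave j N (b + pi / 2)) s \<omega>)"
proof -
  have "(\<integral>x. 0 / 2 * laplacian p (wave j N b) x + grad p (wave j N b) x \<bullet> H (\<mu> s \<omega>) \<partial>\<mu> s \<omega>) =
      speed j N s \<omega> * obs (wave j N (b + pi / 2)) s \<omega>" for s
  proof -
    have "(\<lambda>x. 0 / 2 * laplacian p (wave j N b) x + grad p (wave j N b) x \<bullet> H (\<mu> s \<omega>)) =
        (\<lambda>x. speed j N s \<omega> * wave j N (b + pi / 2) x)"
      by (simp add: grad_wave inner_axis' speed_def mult_ac)
    then show ?thesis by (simp add: obs_def)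
  qed
  then show ?thesis by (simp add: DK_process_def obs_def)
qed

lemma DK_process_0: "DK_process p 0 H \<mu> f 0 \<omega> = 0"
  unfolding DK_process_def set_integral_singleton_interval by simp

lemma speed_bound: "\<exists>K\<ge>0. \<forall>t\<in>{0..T}. \<forall>\<omega>\<in>space P. \<bar>speed j N t \<omega>\<bar> \<le> K"
proof -
  obtain B where B: "\<And>\<nu>. \<nu> \<in> finite_borel_measures \<Longrightarrow> norm (H \<nu>) \<le> B"
    using bounded_H unfolding bounded_iff by auto
  have "\<bar>speed j N t \<omega>\<bar> \<le> 2 * pi * N * \<bar>B\<bar>" if "t \<in> {0..T}" "\<omega> \<in> space P" for t \<omega>
  proof -
    have "\<bar>H (\<mu> t \<omega>) $ j\<bar> \<le> \<bar>B\<bar>"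
      using component_le_norm_cart[of "H (\<mu> t \<omega>)" j] B[OF finite_borel_measures_path[OF that]] by linarith
    then show ?thesis by (auto simp: speed_def abs_mult intro!: mult_left_mono)
  qed
  then show ?thesis by (intro exI[of _ "2 * pi * N * \<bar>B\<bar>"]) auto
qed

lemma speed_measurable:
  assumes "\<omega> \<in> space P"
  shows "(\<lambda>s. speed j N s \<omega>) \<in> borel_measurable (restrict_space borel {0..T})"
proof -
  have [measurable]: "(\<lambda>s. H (\<mu> s \<omega>)) \<in> borel_measurable (restrict_space borel {0..T})"
    by (rule measurable_compose[OF continuous_map_into_borel_of_measurable[OF path_continuous[OF assms]] H])
  have [measurable]: "(\<lambda>x::real^'n. x $ j) \<in> borel_measurable borel"
    by (intro borel_measurable_continuous_onI continuous_intros)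
  show ?thesis unfolding speed_def by measurable
qed

lemma drift_measurable:
  assumes "continuous_on UNIV f" and "bounded (range f)" and \<omega>: "\<omega> \<in> space P"
  shows "set_borel_measurable lborel {0..T} (\<lambda>s. speed j N s \<omega> * obs f s \<omega>)"
proof -
  have [measurable]: "(\<lambda>s. obs f s \<omega>) \<in> borel_measurable (restrict_space borel {0..T})"
    by (rule borel_measurable_continuous_on_restrict[OF obs_continuous[OF assms]])
  note [measurable] = speed_measurable[OF \<omega>]
  have "(\<lambda>s. speed j N s \<omega> * obs f s \<omega>) \<in> borel_measurable (restrict_space borel {0..T})"
    by measurable
  then show ?thesis
    by (simp add: set_borel_measurable_def borel_measurable_restrict_space_iff)
qed

lemma drift_bounded:
  assumes "continuous_on UNIV f" and "bounded (range f)" and \<omega>: "\<omega> \<in> space P"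
  shows "bounded ((\<lambda>s. speed j N s \<omega> * obs f s \<omega>) ` {0..T})"
proof -
  have "compact ((\<lambda>s. obs f s \<omega>) ` {0..T})"
    using obs_continuous[OF assms] by (intro compact_continuous_image) auto
  then obtain B where B: "\<And>s. s \<in> {0..T} \<Longrightarrow> \<bar>obs f s \<omega>\<bar> \<le> B"
    using compact_imp_bounded[of "(\<lambda>s. obs f s \<omega>) ` {0..T}"] unfolding bounded_iff by (auto simp del: atLeastAtMost_iff)
  obtain K where "K \<ge> 0" and K: "\<And>s. s \<in> {0..T} \<Longrightarrow> \<bar>speed j N s \<omega>\<bar> \<le> K"
    using speed_bound \<omega> by blast
  show ?thesis
    by (rule boundedI[of _ "K * B"]) (use K B \<open>K \<ge> 0\<close> in \<open>auto simp: abs_mult intro!: mult_mono\<close>)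
qed

section \<open>Conservation of mass and bounds for the observables\<close>

text \<open>For the constant function 1 both the drift and the quadratic variation vanish. Hence the
  squared deviation of the mass from its initial value is a nonnegative local martingale started at
  0, so it is almost surely zero at each time and, by continuity of paths, at all times at
  once.\<close>

lemma mass_conserved: "AE \<omega> in P. \<forall>t\<in>{0..T}. obs (\<lambda>_. 1) t \<omega> = obs (\<lambda>_. 1) 0 \<omega>"
proof -
  fix j :: 'n
  let ?M = "DK_process p 0 H \<mu> (wave j 0 0)"
  let ?A = "\<lambda>t \<omega>. LINT s:{0..t}|lborel. obs (\<lambda>x. (norm (grad p (wave j 0 0) x))\<^sup>2) s \<omega>"
  have one: "wave j 0 0 = (\<lambda>_. 1)" by (auto simp: wave_zero)
  have M: "?M t \<omega> = obs (\<lambda>_. 1) t \<omega> - obs (\<lambda>_. 1) 0 \<omega>" for t \<omega>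
    unfolding DK_process_wave by (simp add: one speed_def set_lebesgue_integral_def)
  have A: "?A t \<omega> = 0" for t \<omega>
    by (simp add: grad_wave obs_def set_lebesgue_integral_def)
  have lm: "continuous_local_martingale P \<F> T (\<lambda>t \<omega>. (?M t \<omega>)\<^sup>2)"
    using DK_martingale(3)[OF wave_Cb[of j 0 0]] unfolding quadratic_variation_def A by simp
  have "AE \<omega> in P. ?M t \<omega> = 0" if "t \<in> {0..T}" for t
    using nonneg_local_martingale_zero[OF P subalgebra_filtration lm _ _ that] by (simp add: DK_process_0)
  with AE_zero_continuous_paths[OF T DK_martingale(1)[OF wave_Cb[of j 0 0]]]
  have "AE \<omega> in P. \<forall>t\<in>{0..T}. ?M t \<omega> = 0" by blast
  then show ?thesis by (simp add: M)
qed


lemma obs_wave_bound: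
  assumes "t \<in> {0..T}" and "\<omega> \<in> space P"
  shows "\<bar>obs (wave j N b) t \<omega>\<bar> \<le> obs (\<lambda>_. 1) t \<omega>"
  unfolding obs_def
  by (rule finite_borel_measures_integral_bound[OF finite_borel_measures_path[OF assms] wave_continuous wave_bound])

lemma wave_square_continuous: "continuous_on UNIV (\<lambda>x. (wave j N b x)\<^sup>2)"
  by (intro continuous_intros wave_continuous)

lemma wave_square_le_one: "(wave j N b x)\<^sup>2 \<le> 1"
  using wave_bound[of j N b x] by (simp add: abs_square_le_1)

lemma wave_square_bounded: "bounded (range (\<lambda>x. (wave j N b x)\<^sup>2))"
  by (rule boundedI[of _ 1]) (use wave_square_le_one in auto)

lemma obs_grad_wave:
  "obs (\<lambda>x. (norm (grad p (wave j N b) x))\<^sup>2) t \<omega> = (2 * pi * N)\<^sup>2 * obs (\<lambda>x. (wave j N (b + pi / 2) x)\<^sup>2) t \<omega>"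
proof -
  have "(norm (grad p (wave j N b) x))\<^sup>2 = (2 * pi * N)\<^sup>2 * (wave j N (b + pi / 2) x)\<^sup>2" for x
    unfolding grad_wave power2_norm_eq_inner inner_axis_axis by (simp add: power2_eq_square)
  then show ?thesis by (simp add: obs_def)
qed

lemma obs_wave_square:
  assumes "t \<in> {0..T}" and "\<omega> \<in> space P"
  shows "0 \<le> obs (\<lambda>x. (wave j N b x)\<^sup>2) t \<omega>" "obs (\<lambda>x. (wave j N b x)\<^sup>2) t \<omega> \<le> obs (\<lambda>_. 1) t \<omega>"
proof -
  show "0 \<le> obs (\<lambda>x. (wave j N b x)\<^sup>2) t \<omega>"
    by (simp add: obs_def)
  have "\<bar>obs (\<lambda>x. (wave j N b x)\<^sup>2) t \<omega>\<bar> \<le> obs (\<lambda>_. 1) t \<omega>"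
    unfolding obs_def
    by (rule finite_borel_measures_integral_bound[OF finite_borel_measures_path[OF assms] wave_square_continuous])
      (simp add: wave_square_le_one)
  then show "obs (\<lambda>x. (wave j N b x)\<^sup>2) t \<omega> \<le> obs (\<lambda>_. 1) t \<omega>" by linarith
qed

lemma obs_wave_square_sum:
  assumes "t \<in> {0..T}" and "\<omega> \<in> space P"
  shows "obs (\<lambda>x. (wave j N (b + pi / 2) x)\<^sup>2) t \<omega> + obs (\<lambda>x. (wave j N b x)\<^sup>2) t \<omega> = obs (\<lambda>_. 1) t \<omega>"
proof -
  have "integrable (\<mu> t \<omega>) (\<lambda>x. (wave j N b x)\<^sup>2)" for b
    by (rule finite_borel_measures_integrable[OF finite_borel_measures_path[OF assms]
          wave_square_continuous wave_square_bounded])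
  from Bochner_Integration.integral_add[OF this[of "b + pi / 2"] this[of b]]
  show ?thesis by (simp add: obs_def wave_square_sum)
qed

section \<open>Growth of the mean squares\<close>

text \<open>The quadratic variation prescribed for the martingale part of
  \<open>obs (wave j N b)\<close>.\<close>

definition energy :: "'n \<Rightarrow> nat \<Rightarrow> real \<Rightarrow> real \<Rightarrow> 'w \<Rightarrow> real" where
  "energy j N b t \<omega> = (LINT s:{0..t}|lborel. obs (\<lambda>x. (norm (grad p (wave j N b) x))\<^sup>2) s \<omega>)"

lemma energy_integrable:
  assumes "\<omega> \<in> space P"
  shows "set_integrable lborel {0..T} (\<lambda>s. obs (\<lambda>x. (norm (grad p (wave j N b) x))\<^sup>2) s \<omega>)"
  unfolding obs_grad_wave
  by (intro borel_integrable_atLeastAtMost' continuous_intros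
      obs_continuous[OF wave_square_continuous wave_square_bounded assms])

lemma set_integral_bound_from_zero:
  assumes b: "set_integrable lborel {0..T} f" and t: "t \<in> {0..T}" and K: "\<And>s. s \<in> {0..T} \<Longrightarrow> \<bar>f s\<bar> \<le> K"
  shows "\<bar>LINT s:{0..t}|lborel. f s\<bar> \<le> K * T"
proof -
  have "0 \<le> K" using K[of 0] T by auto
  have "(LINT s:{0..t}|lborel. f s) = (LINT s:{0<..t}|lborel. f s)"
    using set_integral_interval_diff[OF b, of 0 t] t unfolding set_integral_singleton_interval by simp
  also have "\<bar>\<dots>\<bar> \<le> K * (t - 0)"
    by (rule set_integral_interval_bound) (use t K in \<open>auto intro: set_integrable_subset[OF b]\<close>)
  also have "\<dots> \<le> K * T" using t \<open>0 \<le> K\<close> by (simp add: mult_left_mono)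
  finally show ?thesis .
qed

text \<open>With constant mass m, the observable, its martingale part M and the energy A are all
  bounded. So M^2 - A has mean zero although it is only assumed to be a local martingale, and the
  Ito formula for the mean square applies with A in place of M^2.\<close>

lemma expectation_square_obs_wave:
  assumes mass: "AE \<omega> in P. \<forall>t\<in>{0..T}. obs (\<lambda>_. 1) t \<omega> = m"
  shows "(\<integral>\<omega>. (obs (wave j N b) T \<omega>)\<^sup>2 - (obs (wave j N b) 0 \<omega>)\<^sup>2 \<partial>P) = (\<integral>\<omega>. energy j N b T \<omega> \<partial>P) +
    (\<integral>\<omega>. (LINT s:{0..T}|lborel. 2 * obs (wave j N b) s \<omega> * (speed j N s \<omega> * obs (wave j N (b + pi / 2)) s \<omega>)) \<partial>P)"
    and "integrable P (energy j N b T)"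
proof -
  interpret prob_space P by (rule P)
  let ?X = "obs (wave j N b)" and ?M = "DK_process p 0 H \<mu> (wave j N b)" and ?A = "energy j N b"
  let ?b = "\<lambda>s \<omega>. speed j N s \<omega> * obs (wave j N (b + pi / 2)) s \<omega>"
  have T0: "0 \<in> {0..T}" and TT: "T \<in> {0..T}" using T by auto
  have m0: "0 \<le> m"
  proof -
    have "AE \<omega> in P. 0 \<le> m"
      using mass by eventually_elim (use T0 in \<open>force simp: obs_def\<close>)
    then show ?thesis by simp
  qed
  obtain K where K0: "K \<ge> 0" and K: "\<And>t \<omega>. t \<in> {0..T} \<Longrightarrow> \<omega> \<in> space P \<Longrightarrow> \<bar>speed j N t \<omega>\<bar> \<le> K"
    using speed_bound by blast
  \<comment> \<open>Bounds the martingale part: m for the observable at each of the times t and 0,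
    and K m T for the drift. It bounds the observable as well.\<close>
  define c where "c = 2 * m + K * m * T"
  \<comment> \<open>The squared gradient is at most (2 pi N)^2, integrated over mass m and time
    T.\<close>
  define e where "e = (2 * pi * N)\<^sup>2 * m * T"
  have int_b: "set_integrable lborel {0..T} (\<lambda>s. ?b s \<omega>)" if \<omega>: "\<omega> \<in> space P" for \<omega>
  proof -
    obtain B where "\<And>s. s \<in> {0..T} \<Longrightarrow> \<bar>?b s \<omega>\<bar> \<le> B"
      using drift_bounded[OF wave_continuous wave_bounded \<omega>, of j N j N "b + pi / 2"]
      unfolding bounded_iff by (auto simp del: atLeastAtMost_iff)
    with drift_measurable[OF wave_continuous wave_bounded \<omega>] show ?thesis
      by (rule set_integrable_bounded)
  qed
  have bb: "AE \<omega> in P. \<forall>t\<in>{0..T}. \<bar>?b t \<omega>\<bar> \<le> K * m"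
    using mass AE_space
  proof eventually_elim
    case (elim \<omega>)
    show ?case
    proof
      fix t assume t: "t \<in> {0..T}"
      have "\<bar>speed j N t \<omega>\<bar> * \<bar>obs (wave j N (b + pi / 2)) t \<omega>\<bar> \<le> K * m"
        by (rule mult_mono) (use K[OF t elim(2)] obs_wave_bound[OF t elim(2)] elim(1) t K0 in auto)
      then show "\<bar>?b t \<omega>\<bar> \<le> K * m" by (simp add: abs_mult)
    qed
  qed
  have bX': "AE \<omega> in P. \<forall>t\<in>{0..T}. \<bar>?X t \<omega>\<bar> \<le> m"
    using mass AE_space by eventually_elim (metis obs_wave_bound)
  then have bX: "AE \<omega> in P. \<forall>t\<in>{0..T}. \<bar>?X t \<omega>\<bar> \<le> c"
  proof eventually_elim
    case (elim \<omega>)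
    have "m \<le> c" unfolding c_def using m0 K0 T by simp
    with elim show ?case by (meson order_trans)
  qed
  have bM: "AE \<omega> in P. \<forall>t\<in>{0..T}. \<bar>?M t \<omega>\<bar> \<le> c"
    using bX' bb AE_space
  proof eventually_elim
    case (elim \<omega>)
    show ?case
    proof
      fix t assume t: "t \<in> {0..T}"
      have "\<bar>LINT s:{0..t}|lborel. ?b s \<omega>\<bar> \<le> K * m * T"
        by (rule set_integral_bound_from_zero[OF int_b[OF elim(3)] t]) (use elim(2) in blast)
      moreover have "\<bar>?X t \<omega>\<bar> \<le> m" "\<bar>?X 0 \<omega>\<bar> \<le> m" using elim(1) t T0 by blast+
      ultimately show "\<bar>?M t \<omega>\<bar> \<le> c" unfolding DK_process_wave c_def by linarith
    qed
  qed
  have bA: "AE \<omega> in P. \<forall>t\<in>{0..T}. \<bar>?A t \<omega>\<bar> \<le> e"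
    using mass AE_space
  proof eventually_elim
    case (elim \<omega>)
    show ?case
    proof
      fix t assume t: "t \<in> {0..T}"
      show "\<bar>?A t \<omega>\<bar> \<le> e"
        unfolding energy_def e_def
      proof (rule set_integral_bound_from_zero[OF energy_integrable[OF elim(2)] t])
        fix s assume s: "s \<in> {0..T}"
        show "\<bar>obs (\<lambda>x. (norm (grad p (wave j N b) x))\<^sup>2) s \<omega>\<bar> \<le> (2 * pi * N)\<^sup>2 * m"
          unfolding obs_grad_wave using obs_wave_square[OF s elim(2), of j N "b + pi / 2"] elim(1) s
          by (auto simp: abs_mult intro!: mult_left_mono)
      qed
    qed
  qed
  note mart = DK_martingale[OF wave_Cb[of j N b], folded energy_def]
  have MP: "?M t \<in> borel_measurable P" if "t \<in> {0..T}" for t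
    using mart(2) that by (auto simp: martingale_def)
  have "adapted_process \<F> T ?A" using mart(3) by (auto simp: quadratic_variation_def)
  then have AP: "?A T \<in> borel_measurable P"
    using TT unfolding adapted_process_def by (blast intro: measurable_from_subalg[OF subalgebra_filtration])
  show intA: "integrable P (?A T)"
    by (rule integrable_const_bound[where B = e]) (use AE_interval_at[OF bA TT] AP in auto)
  have intM: "integrable P (\<lambda>\<omega>. (?M T \<omega>)\<^sup>2)"
  proof (rule integrable_const_bound[where B = "c\<^sup>2"])
    show "AE \<omega> in P. norm ((?M T \<omega>)\<^sup>2) \<le> c\<^sup>2"
      using AE_interval_at[OF bM TT] by eventually_elim (simp add: abs_le_square_iff[symmetric])
  qed (use MP[OF TT] in measurable)
  have lm: "continuous_local_martingale P \<F> T (\<lambda>t \<omega>. (?M t \<omega>)\<^sup>2 - ?A t \<omega>)"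
    using mart(3) by (simp add: quadratic_variation_def)
  have A0: "?A 0 \<omega> = 0" for \<omega>
    unfolding energy_def by (rule set_integral_singleton_interval)
  have "(\<integral>\<omega>. (?M T \<omega>)\<^sup>2 - ?A T \<omega> \<partial>P) = 0"
  proof (rule bounded_local_martingale_expectation[OF P subalgebra_filtration lm _ _ TT])
    show "AE \<omega> in P. \<forall>t\<in>{0..T}. \<bar>(?M t \<omega>)\<^sup>2 - ?A t \<omega>\<bar> \<le> c\<^sup>2 + e"
      using bM bA
    proof eventually_elim
      case (elim \<omega>)
      show ?case
      proof
        fix t assume t: "t \<in> {0..T}"
        have "\<bar>?M t \<omega>\<bar> \<le> \<bar>c\<bar>" using elim(1) t by fastforce
        then have "(?M t \<omega>)\<^sup>2 \<le> c\<^sup>2" by (simp add: abs_le_square_iff)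
        moreover have "\<bar>?A t \<omega>\<bar> \<le> e" using elim(2) t by blast
        moreover have "0 \<le> (?M t \<omega>)\<^sup>2" by simp
        ultimately show "\<bar>(?M t \<omega>)\<^sup>2 - ?A t \<omega>\<bar> \<le> c\<^sup>2 + e" by linarith
      qed
    qed
  qed (simp add: DK_process_0 A0)
  then have "(\<integral>\<omega>. (?M T \<omega>)\<^sup>2 - (?M 0 \<omega>)\<^sup>2 \<partial>P) = (\<integral>\<omega>. ?A T \<omega> \<partial>P)"
    using intM intA by (simp add: DK_process_0)
  then show "(\<integral>\<omega>. (?X T \<omega>)\<^sup>2 - (?X 0 \<omega>)\<^sup>2 \<partial>P) = (\<integral>\<omega>. ?A T \<omega> \<partial>P) +
      (\<integral>\<omega>. (LINT s:{0..T}|lborel. 2 * ?X s \<omega> * ?b s \<omega>) \<partial>P)"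
    using expectation_square_semimartingale[OF P subalgebra_filtration T mart(2,1)
        obs_adapted[OF wave_continuous wave_bounded] obs_continuous_paths[OF wave_continuous wave_bounded]
        drift_measurable[OF wave_continuous wave_bounded] drift_bounded[OF wave_continuous wave_bounded]
        bX bM bb]
    by (simp add: DK_process_wave)
qed

text \<open>The squared gradients at phases 0 and pi/2 add up to the constant (2 pi N)^2, so the
  measure enters only through its mass.\<close>

lemma energy_sum:
  assumes "\<omega> \<in> space P" and "\<forall>t\<in>{0..T}. obs (\<lambda>_. 1) t \<omega> = m"
  shows "energy j N 0 T \<omega> + energy j N (pi / 2) T \<omega> = (2 * pi * N)\<^sup>2 * m * T"
proof -
  have "energy j N 0 T \<omega> + energy j N (pi / 2) T \<omega> =
      (LINT s:{0..T}|lborel. (2 * pi * N)\<^sup>2 * obs (\<lambda>x. (wave j N (0 + pi / 2) x)\<^sup>2) s \<omega> +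
        (2 * pi * N)\<^sup>2 * obs (\<lambda>x. (wave j N (pi / 2 + pi / 2) x)\<^sup>2) s \<omega>)"
    using set_integral_add(2)[OF energy_integrable[OF assms(1), of j N 0] energy_integrable[OF assms(1), of j N "pi / 2"]]
    unfolding energy_def obs_grad_wave by simp
  also have "\<dots> = (LINT s:{0..T}|lborel. (2 * pi * N)\<^sup>2 * m)"
  proof (rule set_lebesgue_integral_cong)
    show "\<forall>s. s \<in> {0..T} \<longrightarrow> (2 * pi * N)\<^sup>2 * obs (\<lambda>x. (wave j N (0 + pi / 2) x)\<^sup>2) s \<omega> +
        (2 * pi * N)\<^sup>2 * obs (\<lambda>x. (wave j N (pi / 2 + pi / 2) x)\<^sup>2) s \<omega> = (2 * pi * N)\<^sup>2 * m"
    proof (intro allI impI)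
      fix s assume s: "s \<in> {0..T}"
      show "(2 * pi * N)\<^sup>2 * obs (\<lambda>x. (wave j N (0 + pi / 2) x)\<^sup>2) s \<omega> +
        (2 * pi * N)\<^sup>2 * obs (\<lambda>x. (wave j N (pi / 2 + pi / 2) x)\<^sup>2) s \<omega> = (2 * pi * N)\<^sup>2 * m"
        using obs_wave_square_sum[OF s assms(1), of j N "pi / 2"] assms(2) s
        by (simp add: distrib_left[symmetric] add.commute)
    qed
  qed simp
  also have "\<dots> = (2 * pi * N)\<^sup>2 * m * T"
    using T by (simp add: set_lebesgue_integral_def)
  finally show ?thesis .
qed

section \<open>Contradiction at large frequency\<close>

text \<open>Add the mean square formulas for the two phases: the drifts cancel and the energies add
  up to the left-hand side. On the other side each final square is at most m^2 and the initial
  squares enter with a minus sign, whence the factor 2.\<close>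

lemma energy_bounded_by_mass:
  fixes N :: nat
  assumes mass: "AE \<omega> in P. \<forall>t\<in>{0..T}. obs (\<lambda>_. 1) t \<omega> = m"
  shows "(2 * pi * N)\<^sup>2 * m * T \<le> 2 * m\<^sup>2"
proof -
  interpret prob_space P by (rule P)
  fix j :: 'n
  let ?X = "obs (wave j N 0)" and ?Y = "obs (wave j N (pi / 2))"
  have TT: "T \<in> {0..T}" using T by auto
  have flip: "obs (wave j N (pi / 2 + pi / 2)) s \<omega> = - ?X s \<omega>" for s \<omega>
    using wave_half_turn[of j N 0] by (simp add: obs_def)
  \<comment> \<open>Advancing the phase pi/2 once more gives pi, which is minus phase 0. This sign
    is what makes the drift a rotation.\<close>
  have drift: "(LINT s:{0..T}|lborel. 2 * ?Y s \<omega> * (speed j N s \<omega> * obs (wave j N (pi / 2 + pi / 2)) s \<omega>)) =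
      - (LINT s:{0..T}|lborel. 2 * ?X s \<omega> * (speed j N s \<omega> * obs (wave j N (0 + pi / 2)) s \<omega>))" for \<omega>
    unfolding flip by (simp add: set_lebesgue_integral_def mult_ac)
  have "(\<integral>\<omega>. (?X T \<omega>)\<^sup>2 - (?X 0 \<omega>)\<^sup>2 \<partial>P) + (\<integral>\<omega>. (?Y T \<omega>)\<^sup>2 - (?Y 0 \<omega>)\<^sup>2 \<partial>P) =
      (\<integral>\<omega>. energy j N 0 T \<omega> \<partial>P) + (\<integral>\<omega>. energy j N (pi / 2) T \<omega> \<partial>P)"
    unfolding expectation_square_obs_wave(1)[OF mass] drift by simp
  also have "\<dots> = (\<integral>\<omega>. energy j N 0 T \<omega> + energy j N (pi / 2) T \<omega> \<partial>P)"
    by (rule Bochner_Integration.integral_add[symmetric]) (rule expectation_square_obs_wave(2)[OF mass])+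
  also have "\<dots> = (\<integral>\<omega>. (2 * pi * N)\<^sup>2 * m * T \<partial>P)"
  proof (rule integral_cong_AE)
    show "AE \<omega> in P. energy j N 0 T \<omega> + energy j N (pi / 2) T \<omega> = (2 * pi * N)\<^sup>2 * m * T"
      using mass AE_space by eventually_elim (rule energy_sum)
  qed (use expectation_square_obs_wave(2)[OF mass] in auto)
  also have "\<dots> = (2 * pi * N)\<^sup>2 * m * T" by (simp add: prob_space)
  finally have eq: "(2 * pi * N)\<^sup>2 * m * T =
    (\<integral>\<omega>. (?X T \<omega>)\<^sup>2 - (?X 0 \<omega>)\<^sup>2 \<partial>P) + (\<integral>\<omega>. (?Y T \<omega>)\<^sup>2 - (?Y 0 \<omega>)\<^sup>2 \<partial>P)" by simp
  have le: "(\<integral>\<omega>. (obs (wave j N b) T \<omega>)\<^sup>2 - (obs (wave j N b) 0 \<omega>)\<^sup>2 \<partial>P) \<le> m\<^sup>2" for b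
  proof -
    have "AE \<omega> in P. (obs (wave j N b) T \<omega>)\<^sup>2 - (obs (wave j N b) 0 \<omega>)\<^sup>2 \<le> m\<^sup>2"
      using mass AE_space
    proof eventually_elim
      case (elim \<omega>)
      have "\<bar>obs (wave j N b) T \<omega>\<bar> \<le> \<bar>m\<bar>"
        using obs_wave_bound[OF TT elim(2), of j N b] elim(1) TT by auto
      then have "(obs (wave j N b) T \<omega>)\<^sup>2 \<le> m\<^sup>2" by (simp add: abs_le_square_iff)
      moreover have "0 \<le> (obs (wave j N b) 0 \<omega>)\<^sup>2" by simp
      ultimately show ?case by linarith
    qed
    then have "(\<integral>\<omega>. (obs (wave j N b) T \<omega>)\<^sup>2 - (obs (wave j N b) 0 \<omega>)\<^sup>2 \<partial>P) \<le> (\<integral>\<omega>. m\<^sup>2 \<partial>P)"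
      by (intro integral_mono_AE') auto
    then show ?thesis by (simp add: prob_space)
  qed
  from eq le[of 0] le[of "pi / 2"] show ?thesis by linarith
qed

text \<open>A positive mass m could be cancelled once from the energy estimate, leaving (2 pi N)^2 T
  \<le> 2 m for every N, which fails for large N.\<close>

lemma initial_mass_zero:
  assumes \<nu>: "\<nu> \<in> finite_borel_measures" and init: "AE \<omega> in P. \<mu> 0 \<omega> = \<nu>"
  shows "\<nu> = null_measure borel"
proof -
  interpret N: finite_measure \<nu> using \<nu> by (simp add: finite_borel_measures_def)
  define m where "m = measure \<nu> (space \<nu>)"
  \<comment> \<open>The deterministic initial measure is what turns the conserved mass into a single
    constant.\<close>
  have mass: "AE \<omega> in P. \<forall>t\<in>{0..T}. obs (\<lambda>_. 1) t \<omega> = m"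
    using mass_conserved init by eventually_elim (auto simp: obs_def m_def)
  have "m = 0"
  proof (rule ccontr)
    assume "m \<noteq> 0"
    then have m: "m > 0" by (simp add: m_def zero_less_measure_iff)
    \<comment> \<open>A bound on N itself is enough, since N \<le> N^2 \<le> (2 pi N)^2 for positive
      integers.\<close>
    obtain N :: nat where N: "2 * m / T < N" using reals_Archimedean2 by blast
    have "N > 0" using N m T by (metis divide_pos_pos mult_pos_pos of_nat_0_less_iff order.strict_trans zero_less_numeral)
    then have "real N * 1 \<le> real N * real N" by (intro mult_left_mono) auto
    also have "\<dots> = 1 * (real N)\<^sup>2" by (simp add: power2_eq_square)
    also have "\<dots> \<le> (2 * pi)\<^sup>2 * (real N)\<^sup>2"
      by (intro mult_right_mono one_le_power) (use pi_ge_two in auto)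
    finally have "real N \<le> (2 * pi * N)\<^sup>2" by (simp add: power_mult_distrib)
    with N have "2 * m / T < (2 * pi * N)\<^sup>2" by linarith
    then have "2 * m < (2 * pi * N)\<^sup>2 * T" using T by (simp add: divide_less_eq)
    then have "m * (2 * m) < m * ((2 * pi * N)\<^sup>2 * T)" using m by (rule mult_strict_left_mono)
    with energy_bounded_by_mass[OF mass, of N] show False by (simp add: power2_eq_square mult_ac)
  qed
  then have "emeasure \<nu> (space \<nu>) = 0" by (simp add: m_def N.emeasure_eq_measure)
  then have "emeasure \<nu> A = 0" for A
    by (metis emeasure_mono emeasure_notin_sets le_zero_eq sets.sets_into_space sets.top)
  then show ?thesis
    using \<nu> by (intro measure_eqI) (auto simp: finite_borel_measures_def)
qed

end

text \<open>The two spaces differ only in the covering map, so both cases are the contrapositive of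
  \<open>initial_mass_zero\<close>.\<close>

theorem theorem1p2:
  fixes P :: "'w measure" and T :: real
  assumes "prob_space P" and "complete_measure P" and "0 < T"
  shows
    "(\<forall>(H :: (real ^ 'n) measure \<Rightarrow> real ^ 'n) \<nu>.
        H \<in> borel_measurable (borel_of narrow_topology) \<longrightarrow>
        bounded (H ` finite_borel_measures) \<longrightarrow>
        \<nu> \<in> finite_borel_measures \<longrightarrow> \<nu> \<noteq> null_measure borel \<longrightarrow>
        \<not> (\<exists>\<mu>. DK_solution (\<lambda>x. x) P T 0 H \<mu> \<and> (AE \<omega> in P. \<mu> 0 \<omega> = \<nu>))) \<and>
     (\<forall>(H :: ('n torus) measure \<Rightarrow> real ^ 'n) \<nu>.
        H \<in> borel_measurable (borel_of narrow_topology) \<longrightarrow>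
        bounded (H ` finite_borel_measures) \<longrightarrow>
        \<nu> \<in> finite_borel_measures \<longrightarrow> \<nu> \<noteq> null_measure borel \<longrightarrow>
        \<not> (\<exists>\<mu>. DK_solution torus_proj P T 0 H \<mu> \<and> (AE \<omega> in P. \<mu> 0 \<omega> = \<nu>)))"
proof -
  have inviscid: "DK_inviscid p P T H \<mu>"
    if "flat_covering p" "H \<in> borel_measurable (borel_of narrow_topology)"
      "bounded (H ` finite_borel_measures)" "DK_solution p P T 0 H \<mu>"
    for p :: "real^'n \<Rightarrow> 'm::topological_space" and H :: "'m measure \<Rightarrow> real^'n" and \<mu>
    using that assms by (simp add: DK_inviscid_def DK_inviscid_axioms_def)
  show ?thesis
    using DK_inviscid.initial_mass_zero[OF inviscid[OF flat_covering_euclidean]]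
      DK_inviscid.initial_mass_zero[OF inviscid[OF flat_covering_torus]] by blast
qed

end
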